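(* Let $\mathcal B$ be a bicartesian closed category. Then every bicartesian closed canonical transformation in $\mathcal B$ is g-dinatural; that is, if $\alpha$ is a canonical transformation from $F$ to $G$ with associated graph $\Gamma$ (where $F,G\in Ob(\mathcal F_{\mathcal B})$), then $\alpha$ is g-dinatural from $F$ to $G$ with the graph $\Gamma$.
   Context: **Graphs.** Let $m,n\ge 0$ and let $M=\{x_1,\ldots,x_m\}+\{y_1,\ldots,y_n\}$ (disjoint union; left-hand side and right-hand side argument places), with a sign function $l:M\to\{1,-1\}$ ($u$ is positive if $l(u)=1$, negative if $l(u)=-1$). Let $G$ be a finite set disjoint from $M$, $V=M\cup G$, and $E$ a set of unordered pairs from $V$ (edges). Components are the connected components of $(V,E)$, enumerated $1,\ldots,k$, and $\pi:V\to\{1,\ldots,k\}$ sends a vertex to the number of its component. $(V,l,E)$ is a *graph* iff: every argument place belongs to some edge; $\{x_i,x_j\}\in E$ iff $l(x_i)=-l(x_j)$ and $x_i,x_j$ are in the same component; $\{y_i,y_j\}\in E$ iff $l(y_i)=-l(y_j)$ and $y_i,y_j$ are in the same component; $\{x_i,y_j\}\in E$ iff $l(x_i)=l(y_j)$ and $x_i,y_j$ are in the same component; and if a component $K$ includes an edge between two argument places then $K\cap G=\emptyset$, otherwise $K\cap G=\{g\}$ for some $g$ and $\{u,g\}\in E$ for all $u\in K\setminus\{g\}$. Up to the names of elements of $G$, a graph is thus determined by its signed argument places, their partition into components, and the number of components that consist of a single vertex of $G$; graphs below are described in this way. **g-dinatural transformations.** Put $\mathcal B^{1}=\mathcal B$,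 $\mathcal B^{-1}=\mathcal B^{op}$. Let $\Gamma$ be a graph with $k$ components, $T:\mathcal B^{l(x_1)}\times\cdots\times\mathcal B^{l(x_m)}\to\mathcal B$ and $S:\mathcal B^{l(y_1)}\times\cdots\times\mathcal B^{l(y_n)}\to\mathcal B$ functors. A family $\alpha(A_1,\ldots,A_k):T(A_{\pi(x_1)},\ldots,A_{\pi(x_m)})\to S(A_{\pi(y_1)},\ldots,A_{\pi(y_n)})$ indexed by all $k$-tuples of objects is *g-dinatural from $T$ to $S$ with the graph $\Gamma$* if for every $i\in\{1,\ldots,k\}$, all objects $A_q$ ($q\ne i$) and every $f:A\to C$, $$S(u_1,\ldots,u_n)\circ\alpha(A_1,\ldots,C,\ldots,A_k)\circ T(v_1,\ldots,v_m)=S(u'_1,\ldots,u'_n)\circ\alpha(A_1,\ldots,A,\ldots,A_k)\circ T(v'_1,\ldots,v'_m)$$ ($C$, resp. $A$, at the $i$-th place), where: for $x_j$ (resp. $y_j$) in component $q\ne i$, $v_j=v'_j=\mathbf 1_{A_q}$ (resp. $u_j=u'_j=\mathbf 1_{A_q}$); for $x_j$ in component $i$: $v_j=f,\ v'_j=\mathbf 1_A$ if $x_j$ is positive, $v_j=\mathbf 1_C,\ v'_j=f$ if negative; for $y_j$ in component $i$: $u_j=\mathbf 1_C,\ u'_j=f$ if $y_j$ is positive, $u_j=f,\ u'_j=\mathbf 1_A$ if negative. **Bicartesian closed categories.** A bicartesian closed category has chosen finite products ($\times$, terminal object $\mathrm I$), finite coproducts ($+$, initial object $\mathrm O$) and,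 for every $A$, a right adjoint $A\to\_$ of $A\times\_$. Its special morphisms are: identities $\mathbf 1_A$; $\delta_A:A\times \mathrm I\vdash A$ (projection) and its inverse $\delta^i_A$; associativity $\mathbf b^{\to}_{A,B,C}:A\times(B\times C)\vdash(A\times B)\times C$ and its inverse $\mathbf b^{\leftarrow}_{A,B,C}$; symmetry $\mathbf c_{A,B}:A\times B\vdash B\times A$; diagonal $\mathbf w_A:A\vdash A\times A$; $\mathbf k_A:A\vdash \mathrm I$; codiagonal $\mathbf m_A:A+A\vdash A$; $\boldsymbol l_A:\mathrm O\vdash A$; injections $\boldsymbol l^1_{A,B}:A\vdash A+B$, $\boldsymbol l^2_{A,B}:B\vdash A+B$; counit $\varepsilon_{A,B}:A\times(A\to B)\vdash B$; unit $\eta_{A,B}:B\vdash A\to(A\times B)$. ($f:A\vdash B$ means that $f$ has source $A$ and target $B$.) **Objects of $\mathcal F_{\mathcal B}$.** $Ob(\mathcal F_{\mathcal B})$ is the inductively generated set of functors containing the identity functor $1_{\mathcal B}:\mathcal B\to\mathcal B$ and the constant functors $I,O:\mathcal B^0\to\mathcal B$ ($\mathcal B^0$ the trivial category; no argument places) with values $\mathrm I$, $\mathrm O$, and such that if $F:\mathcal B^{l_1}\times\cdots\times\mathcal B^{l_m}\to\mathcal B$ and $G:\mathcal B^{l_{m+1}}\times\cdots\times\mathcal B^{l_{m+n}}\to\mathcal B$ are in it, then so are $F\otimes G$, $F\oplus G$ (of type $\mathcal B^{l_1}\times\cdots\times\mathcal B^{l_{m+n}}\to\mathcal B$) and $F\to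 G$ (of type $\mathcal B^{-l_1}\times\cdots\times\mathcal B^{-l_m}\times\mathcal B^{l_{m+1}}\times\cdots\times\mathcal B^{l_{m+n}}\to\mathcal B$), which send $(x_1,\ldots,x_{m+n})$ to $F(x_1,\ldots,x_m)\,\star\,G(x_{m+1},\ldots,x_{m+n})$ with $\star=\times,+,\to$ respectively. **Canonical transformations** (each a family of morphisms with a graph). They are the least class such that: (i) *Primitive ones.* For $F,G,H\in Ob(\mathcal F_{\mathcal B})$, instantiating the indices of the special morphisms by values $F(\vec A),G(\vec B),H(\vec C)$, with $\vec A,\vec B,\vec C$ arbitrary tuples of objects, gives the primitive canonical transformations $\mathbf 1_F:F\to F$; $\delta_F:F\otimes I\to F$; $\delta^i_F:F\to F\otimes I$; $\mathbf b^{\to}_{F,G,H}:F\otimes(G\otimes H)\to(F\otimes G)\otimes H$; $\mathbf b^{\leftarrow}_{F,G,H}$ in the opposite direction; $\mathbf c_{F,G}:F\otimes G\to G\otimes F$; $\mathbf w_F:F\to F\otimes F$; $\mathbf k_F:F\to I$; $\boldsymbol l_F:O\to F$; $\boldsymbol l^1_{F,G}:F\to F\oplus G$; $\boldsymbol l^2_{F,G}:G\to F\oplus G$; $\mathbf m_F:F\oplus F\to F$; $\varepsilon_{F,G}:F\otimes(F\to G)\to G$; $\eta_{F,G}:G\to(F\to(F\otimes G))$. The graph has one component for each argument place of each of the indices $F,G,H$, consisting of all argument places of source and target that come from this argument place in the displayed occurrences of $F,G,H$ (plus a vertex of $G$ when the graph conditions require it). For example, in $\mathbf k_F$ every $x_j$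 is alone with a vertex $g_j$, and in $\mathbf w_F$ the components are $\{x_j,y_j,y_{m+j}\}$. (ii) *Subtransformations.* If $\alpha$ from $F$ to $G$ with graph $\Gamma$ is canonical, so is $\alpha^{i_1,\ldots,i_l}=\{\alpha(A_1,\ldots,A_{k_\Gamma})\mid A_{i_1}=\cdots=A_{i_l}\}$ ($l\ge1$), from $F$ to $G$, with the graph obtained from $\Gamma$ by merging the components $i_1,\ldots,i_l$ into one component. (iii) If $\alpha$ from $F$ to $G$ (graph $\Phi$) and $\beta$ from $H$ to $J$ (graph $\Psi$) are canonical, so are $\alpha\otimes\beta$ from $F\otimes H$ to $G\otimes J$, $\alpha\oplus\beta$ from $F\oplus H$ to $G\oplus J$, $\alpha\to\beta$ from $G\to H$ to $F\to J$, consisting of the morphisms $\alpha(\vec A)\star\beta(\vec B)$, $\star=\times,+,\to$, for all $\vec A,\vec B$; the graph is the disjoint union of $\Phi$ and $\Psi$, where in the case of $\to$ the graph $\Phi$ is inverted (left and right exchanged and signs reversed). (iv) *Composition.* If $\alpha$ from $F$ to $G$ (graph $\Phi$, argument places $x$'s and $y$'s) and $\beta$ from $G$ to $H$ (graph $\Psi$, argument places $y$'s and $z$'s) are canonical, so is $\beta\alpha$ from $F$ to $H$. Let $\Phi+\Psi$ be the union of $\Phi$ and $\Psi$ along the common $y$'s (with disjoint $G_\Phi,G_\Psi$), with connected components $1,\ldots,k$, and let $\rho(i)$, $\sigma(j)$ be the components of $\Phi+\Psi$ containing the $i$-th component of $\Phi$ and the $j$-th component of $\Psi$. Then $\beta\alpha(A_1,\ldots,A_k)=\beta(A_{\sigma(1)},\ldots,A_{\sigma(k_\Psi)})\circ\alpha(A_{\rho(1)},\ldots,A_{\rho(k_\Phi)})$,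 and the graph $\Psi\Phi$ has one component for every component of $\Phi+\Psi$, whose argument places are the $x$'s and $z$'s lying in it (a single vertex of $G$ if there are none). *)

theory Defs
  imports "HOL-Library.FuncSet"
begin

section \<open>Bicartesian closed categories\<close>

record ('o, 'm) bcc =
  Ob :: "'o set"
  Arr :: "'m set"
  Dom :: "'m \<Rightarrow> 'o"
  Cod :: "'m \<Rightarrow> 'o"
  Id :: "'o \<Rightarrow> 'm"
  Comp :: "'m \<Rightarrow> 'm \<Rightarrow> 'm"
  Prod :: "'o \<Rightarrow> 'o \<Rightarrow> 'o"
  Proj1 :: "'o \<Rightarrow> 'o \<Rightarrow> 'm"
  Proj2 :: "'o \<Rightarrow> 'o \<Rightarrow> 'm"
  Term :: "'o"
  Coprod :: "'o \<Rightarrow> 'o \<Rightarrow> 'o"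
  Inj1 :: "'o \<Rightarrow> 'o \<Rightarrow> 'm"
  Inj2 :: "'o \<Rightarrow> 'o \<Rightarrow> 'm"
  Init :: "'o"
  Exp :: "'o \<Rightarrow> 'o \<Rightarrow> 'o"
  Eval :: "'o \<Rightarrow> 'o \<Rightarrow> 'm"

text \<open>\<open>Comp B g f\<close> is \<open>g\<close> after \<open>f\<close>.  \<open>Exp B A C\<close> is the object \<open>A \<rightarrow> C\<close>, the value at \<open>C\<close> of the
  right adjoint of \<open>A \<times> _\<close>, and \<open>Eval B A C : A \<times> (A \<rightarrow> C) \<turnstile> C\<close> is the counit.\<close>

definition hom :: "('o, 'm) bcc \<Rightarrow> 'o \<Rightarrow> 'o \<Rightarrow> 'm set" where
  "hom B A C = {f \<in> Arr B. Dom B f = A \<and> Cod B f = C}"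

definition pair :: "('o, 'm) bcc \<Rightarrow> 'm \<Rightarrow> 'm \<Rightarrow> 'm" where
  "pair B f g = (THE h. h \<in> hom B (Dom B f) (Prod B (Cod B f) (Cod B g)) \<and>
     Comp B (Proj1 B (Cod B f) (Cod B g)) h = f \<and> Comp B (Proj2 B (Cod B f) (Cod B g)) h = g)"

definition copair :: "('o, 'm) bcc \<Rightarrow> 'm \<Rightarrow> 'm \<Rightarrow> 'm" where
  "copair B f g = (THE h. h \<in> hom B (Coprod B (Dom B f) (Dom B g)) (Cod B f) \<and>
     Comp B h (Inj1 B (Dom B f) (Dom B g)) = f \<and> Comp B h (Inj2 B (Dom B f) (Dom B g)) = g)"

definition prod_arr :: "('o, 'm) bcc \<Rightarrow> 'm \<Rightarrow> 'm \<Rightarrow> 'm" where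
  "prod_arr B f g = pair B (Comp B f (Proj1 B (Dom B f) (Dom B g)))
                           (Comp B g (Proj2 B (Dom B f) (Dom B g)))"

definition coprod_arr :: "('o, 'm) bcc \<Rightarrow> 'm \<Rightarrow> 'm \<Rightarrow> 'm" where
  "coprod_arr B f g = copair B (Comp B (Inj1 B (Cod B f) (Cod B g)) f)
                               (Comp B (Inj2 B (Cod B f) (Cod B g)) g)"

locale bicartesian_closed =
  fixes B :: "('o, 'm) bcc"
  assumes Dom_Ob: "f \<in> Arr B \<Longrightarrow> Dom B f \<in> Ob B"
    and Cod_Ob: "f \<in> Arr B \<Longrightarrow> Cod B f \<in> Ob B"
    and Id_hom: "A \<in> Ob B \<Longrightarrow> Id B A \<in> hom B A A"
    and Comp_hom: "f \<in> hom B A C \<Longrightarrow> g \<in> hom B C D \<Longrightarrow> Comp B g f \<in> hom B A D"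
    and Id_left: "f \<in> hom B A C \<Longrightarrow> Comp B (Id B C) f = f"
    and Id_right: "f \<in> hom B A C \<Longrightarrow> Comp B f (Id B A) = f"
    and Comp_assoc: "f \<in> hom B A C \<Longrightarrow> g \<in> hom B C D \<Longrightarrow> h \<in> hom B D E \<Longrightarrow>
      Comp B h (Comp B g f) = Comp B (Comp B h g) f"
    and Prod_Ob: "A \<in> Ob B \<Longrightarrow> C \<in> Ob B \<Longrightarrow> Prod B A C \<in> Ob B"
    and Proj1_hom: "A \<in> Ob B \<Longrightarrow> C \<in> Ob B \<Longrightarrow> Proj1 B A C \<in> hom B (Prod B A C) A"
    and Proj2_hom: "A \<in> Ob B \<Longrightarrow> C \<in> Ob B \<Longrightarrow> Proj2 B A C \<in> hom B (Prod B A C) C"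
    and Prod_universal: "f \<in> hom B D A \<Longrightarrow> g \<in> hom B D C \<Longrightarrow>
      \<exists>!h. h \<in> hom B D (Prod B A C) \<and> Comp B (Proj1 B A C) h = f \<and> Comp B (Proj2 B A C) h = g"
    and Term_Ob: "Term B \<in> Ob B"
    and Term_universal: "A \<in> Ob B \<Longrightarrow> \<exists>!h. h \<in> hom B A (Term B)"
    and Coprod_Ob: "A \<in> Ob B \<Longrightarrow> C \<in> Ob B \<Longrightarrow> Coprod B A C \<in> Ob B"
    and Inj1_hom: "A \<in> Ob B \<Longrightarrow> C \<in> Ob B \<Longrightarrow> Inj1 B A C \<in> hom B A (Coprod B A C)"
    and Inj2_hom: "A \<in> Ob B \<Longrightarrow> C \<in> Ob B \<Longrightarrow> Inj2 B A C \<in> hom B C (Coprod B A C)"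
    and Coprod_universal: "f \<in> hom B A D \<Longrightarrow> g \<in> hom B C D \<Longrightarrow>
      \<exists>!h. h \<in> hom B (Coprod B A C) D \<and> Comp B h (Inj1 B A C) = f \<and> Comp B h (Inj2 B A C) = g"
    and Init_Ob: "Init B \<in> Ob B"
    and Init_universal: "A \<in> Ob B \<Longrightarrow> \<exists>!h. h \<in> hom B (Init B) A"
    and Exp_Ob: "A \<in> Ob B \<Longrightarrow> C \<in> Ob B \<Longrightarrow> Exp B A C \<in> Ob B"
    and Eval_hom: "A \<in> Ob B \<Longrightarrow> C \<in> Ob B \<Longrightarrow> Eval B A C \<in> hom B (Prod B A (Exp B A C)) C"
    and Exp_universal: "A \<in> Ob B \<Longrightarrow> D \<in> Ob B \<Longrightarrow> f \<in> hom B (Prod B A D) C \<Longrightarrow>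
      \<exists>!g. g \<in> hom B D (Exp B A C) \<and> Comp B (Eval B A C) (prod_arr B (Id B A) g) = f"

text \<open>\<open>curry B A D f\<close> is the transpose \<open>D \<turnstile> A \<rightarrow> C\<close> of \<open>f : A \<times> D \<turnstile> C\<close>.\<close>

definition curry :: "('o, 'm) bcc \<Rightarrow> 'o \<Rightarrow> 'o \<Rightarrow> 'm \<Rightarrow> 'm" where
  "curry B A D f = (THE g. g \<in> hom B D (Exp B A (Cod B f)) \<and>
     Comp B (Eval B A (Cod B f)) (prod_arr B (Id B A) g) = f)"

text \<open>For \<open>f : A' \<turnstile> A\<close> and \<open>g : C \<turnstile> C'\<close>, \<open>exp_arr B f g : A \<rightarrow> C \<turnstile> A' \<rightarrow> C'\<close>.\<close>

definition exp_arr :: "('o, 'm) bcc \<Rightarrow> 'm \<Rightarrow> 'm \<Rightarrow> 'm" where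
  "exp_arr B f g = (let P = Exp B (Cod B f) (Dom B g) in
     curry B (Dom B f) P (Comp B g (Comp B (Eval B (Cod B f) (Dom B g)) (prod_arr B f (Id B P)))))"

subsection \<open>Special morphisms\<close>

definition sp_k :: "('o, 'm) bcc \<Rightarrow> 'o \<Rightarrow> 'm" where
  "sp_k B A = (THE h. h \<in> hom B A (Term B))"

definition sp_l :: "('o, 'm) bcc \<Rightarrow> 'o \<Rightarrow> 'm" where
  "sp_l B A = (THE h. h \<in> hom B (Init B) A)"

definition sp_delta :: "('o, 'm) bcc \<Rightarrow> 'o \<Rightarrow> 'm" where
  "sp_delta B A = Proj1 B A (Term B)"

definition sp_delta_inv :: "('o, 'm) bcc \<Rightarrow> 'o \<Rightarrow> 'm" where
  "sp_delta_inv B A = pair B (Id B A) (sp_k B A)"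

definition sp_b_right :: "('o, 'm) bcc \<Rightarrow> 'o \<Rightarrow> 'o \<Rightarrow> 'o \<Rightarrow> 'm" where
  "sp_b_right B A C D = (let p = Proj1 B A (Prod B C D); q = Proj2 B A (Prod B C D) in
     pair B (pair B p (Comp B (Proj1 B C D) q)) (Comp B (Proj2 B C D) q))"

definition sp_b_left :: "('o, 'm) bcc \<Rightarrow> 'o \<Rightarrow> 'o \<Rightarrow> 'o \<Rightarrow> 'm" where
  "sp_b_left B A C D = (let p = Proj1 B (Prod B A C) D; q = Proj2 B (Prod B A C) D in
     pair B (Comp B (Proj1 B A C) p) (pair B (Comp B (Proj2 B A C) p) q))"

definition sp_c :: "('o, 'm) bcc \<Rightarrow> 'o \<Rightarrow> 'o \<Rightarrow> 'm" where
  "sp_c B A C = pair B (Proj2 B A C) (Proj1 B A C)"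

definition sp_w :: "('o, 'm) bcc \<Rightarrow> 'o \<Rightarrow> 'm" where
  "sp_w B A = pair B (Id B A) (Id B A)"

definition sp_m :: "('o, 'm) bcc \<Rightarrow> 'o \<Rightarrow> 'm" where
  "sp_m B A = copair B (Id B A) (Id B A)"

definition sp_eta :: "('o, 'm) bcc \<Rightarrow> 'o \<Rightarrow> 'o \<Rightarrow> 'm" where
  "sp_eta B A C = curry B A C (Id B (Prod B A C))"

section \<open>Functors of several arguments of mixed variance\<close>

text \<open>A sign is a truth value: \<open>True\<close> is \<open>1\<close>, \<open>False\<close> is \<open>-1\<close>.  An arrow of \<open>\<B>\<^sup>o\<^sup>p\<close> is given by the
  arrow of \<open>\<B>\<close> that it reverses; \<open>sdom\<close>, \<open>scod\<close>, \<open>scomp\<close> are source, target and composition in \<open>\<B>\<close>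
  or \<open>\<B>\<^sup>o\<^sup>p\<close>, according to the sign.\<close>

definition sdom :: "('o, 'm) bcc \<Rightarrow> bool \<Rightarrow> 'm \<Rightarrow> 'o" where
  "sdom B s f = (if s then Dom B f else Cod B f)"

definition scod :: "('o, 'm) bcc \<Rightarrow> bool \<Rightarrow> 'm \<Rightarrow> 'o" where
  "scod B s f = (if s then Cod B f else Dom B f)"

definition scomp :: "('o, 'm) bcc \<Rightarrow> bool \<Rightarrow> 'm \<Rightarrow> 'm \<Rightarrow> 'm" where
  "scomp B s g f = (if s then Comp B g f else Comp B f g)"

definition obs :: "('o, 'm) bcc \<Rightarrow> nat \<Rightarrow> 'o list set" where
  "obs B n = {As. length As = n \<and> set As \<subseteq> Ob B}"

definition arrs :: "('o, 'm) bcc \<Rightarrow> nat \<Rightarrow> 'm list set" where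
  "arrs B n = {fs. length fs = n \<and> set fs \<subseteq> Arr B}"

record ('o, 'm) mfunctor =
  signs :: "bool list"
  omap :: "'o list \<Rightarrow> 'o"
  amap :: "'m list \<Rightarrow> 'm"

definition is_functor :: "('o, 'm) bcc \<Rightarrow> ('o, 'm) mfunctor \<Rightarrow> bool" where
  "is_functor B T \<longleftrightarrow> (let n = length (signs T) in
     (\<forall>As \<in> obs B n. omap T As \<in> Ob B) \<and>
     (\<forall>fs \<in> arrs B n. amap T fs \<in> hom B (omap T (map2 (sdom B) (signs T) fs))
                                      (omap T (map2 (scod B) (signs T) fs))) \<and>
     (\<forall>As \<in> obs B n. amap T (map (Id B) As) = Id B (omap T As)) \<and>
     (\<forall>fs \<in> arrs B n. \<forall>gs \<in> arrs B n.
        map2 (scod B) (signs T) fs = map2 (sdom B) (signs T) gs \<longrightarrow>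
        amap T (map (\<lambda>j. scomp B (signs T ! j) (gs ! j) (fs ! j)) [0..<n])
          = Comp B (amap T gs) (amap T fs)))"

subsection \<open>The objects of \<open>\<F>\<^sub>\<B>\<close>\<close>

text \<open>The generation of the objects is taken to be free: an object is an expression \<open>F\<close>, which
  denotes the functor \<open>funct B F\<close>.\<close>

datatype fob =
    Var
  | One
  | Zero
  | Tensor fob fob (infixr "\<^bold>\<otimes>" 70)
  | Oplus fob fob (infixr "\<^bold>\<oplus>" 65)
  | Arrow fob fob (infixr "\<^bold>\<rightarrow>" 60)

definition combine :: "bool list \<Rightarrow> ('o \<Rightarrow> 'o \<Rightarrow> 'o) \<Rightarrow> ('m \<Rightarrow> 'm \<Rightarrow> 'm) \<Rightarrow>
    ('o, 'm) mfunctor \<Rightarrow> ('o, 'm) mfunctor \<Rightarrow> ('o, 'm) mfunctor" where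
  "combine ls sto sta T S = (let m = length (signs T) in
     \<lparr>signs = ls @ signs S,
      omap = (\<lambda>xs. sto (omap T (take m xs)) (omap S (drop m xs))),
      amap = (\<lambda>fs. sta (amap T (take m fs)) (amap S (drop m fs)))\<rparr>)"

primrec funct :: "('o, 'm) bcc \<Rightarrow> fob \<Rightarrow> ('o, 'm) mfunctor" where
  "funct B Var = \<lparr>signs = [True], omap = hd, amap = hd\<rparr>"
| "funct B One = \<lparr>signs = [], omap = (\<lambda>_. Term B), amap = (\<lambda>_. Id B (Term B))\<rparr>"
| "funct B Zero = \<lparr>signs = [], omap = (\<lambda>_. Init B), amap = (\<lambda>_. Id B (Init B))\<rparr>"
| "funct B (F \<^bold>\<otimes> G) =
     combine (signs (funct B F)) (Prod B) (prod_arr B) (funct B F) (funct B G)"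
| "funct B (F \<^bold>\<oplus> G) =
     combine (signs (funct B F)) (Coprod B) (coprod_arr B) (funct B F) (funct B G)"
| "funct B (F \<^bold>\<rightarrow> G) =
     combine (map Not (signs (funct B F))) (Exp B) (exp_arr B) (funct B F) (funct B G)"

abbreviation sg :: "('o, 'm) bcc \<Rightarrow> fob \<Rightarrow> bool list" where
  "sg B F \<equiv> signs (funct B F)"

abbreviation ar :: "('o, 'm) bcc \<Rightarrow> fob \<Rightarrow> nat" where
  "ar B F \<equiv> length (sg B F)"

section \<open>Graphs\<close>

text \<open>A graph is represented by the signs of its argument places \<open>x\<^sub>i\<close> (left) and \<open>y\<^sub>j\<close> (right), the
  number of its components (here numbered from \<open>0\<close>), and the function \<open>\<pi>\<close> on argument places:
  \<open>lcomp \<Gamma> ! i\<close> is the component of \<open>x\<^sub>i\<close> and \<open>rcomp \<Gamma> ! j\<close> that of \<open>y\<^sub>j\<close>.  The components that contain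
  no argument place are those that consist of a single vertex of \<open>G\<close>.\<close>

record graph =
  lsign :: "bool list"
  rsign :: "bool list"
  ncomp :: nat
  lcomp :: "nat list"
  rcomp :: "nat list"

definition is_graph :: "graph \<Rightarrow> bool" where
  "is_graph \<Gamma> \<longleftrightarrow> length (lcomp \<Gamma>) = length (lsign \<Gamma>) \<and> length (rcomp \<Gamma>) = length (rsign \<Gamma>) \<and>
     set (lcomp \<Gamma>) \<subseteq> {..<ncomp \<Gamma>} \<and> set (rcomp \<Gamma>) \<subseteq> {..<ncomp \<Gamma>}"

subsection \<open>Vertices and edges\<close>

text \<open>The vertices and edges that this data determines; an element of \<open>G\<close> is named by its component.
  The definition of \<open>edges\<close> spells out the conditions on edges in terms of the components, and
  \<open>connected_iff\<close> and \<open>vcomp_vertices\<close> confirm that \<open>vcomp\<close> numbers the connected components.\<close>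

datatype vertex = X nat | Y nat | GV nat

fun vcomp :: "graph \<Rightarrow> vertex \<Rightarrow> nat" where
  "vcomp \<Gamma> (X i) = lcomp \<Gamma> ! i"
| "vcomp \<Gamma> (Y j) = rcomp \<Gamma> ! j"
| "vcomp \<Gamma> (GV c) = c"

definition places :: "graph \<Rightarrow> vertex set" where
  "places \<Gamma> = X ` {..<length (lsign \<Gamma>)} \<union> Y ` {..<length (rsign \<Gamma>)}"

fun joinable :: "graph \<Rightarrow> vertex \<Rightarrow> vertex \<Rightarrow> bool" where
  "joinable \<Gamma> (X i) (X j) = (lsign \<Gamma> ! i \<noteq> lsign \<Gamma> ! j)"
| "joinable \<Gamma> (Y i) (Y j) = (rsign \<Gamma> ! i \<noteq> rsign \<Gamma> ! j)"
| "joinable \<Gamma> (X i) (Y j) = (lsign \<Gamma> ! i = rsign \<Gamma> ! j)"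
| "joinable \<Gamma> (Y i) (X j) = (rsign \<Gamma> ! i = lsign \<Gamma> ! j)"
| "joinable \<Gamma> (GV c) v = False"
| "joinable \<Gamma> v (GV c) = False"

definition place_edges :: "graph \<Rightarrow> vertex set set" where
  "place_edges \<Gamma> = {{u, v} | u v. u \<in> places \<Gamma> \<and> v \<in> places \<Gamma> \<and>
     vcomp \<Gamma> u = vcomp \<Gamma> v \<and> joinable \<Gamma> u v}"

definition gcomps :: "graph \<Rightarrow> nat set" where
  "gcomps \<Gamma> = {c. c < ncomp \<Gamma> \<and> \<not> (\<exists>e \<in> place_edges \<Gamma>. \<exists>u \<in> e. vcomp \<Gamma> u = c)}"

definition vertices :: "graph \<Rightarrow> vertex set" where
  "vertices \<Gamma> = places \<Gamma> \<union> GV ` gcomps \<Gamma>"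

definition edges :: "graph \<Rightarrow> vertex set set" where
  "edges \<Gamma> = place_edges \<Gamma> \<union> {{u, GV c} | u c. u \<in> places \<Gamma> \<and> c \<in> gcomps \<Gamma> \<and> vcomp \<Gamma> u = c}"

lemma vcomp_edge:
  assumes "{u, v} \<in> edges \<Gamma>"
  shows "vcomp \<Gamma> u = vcomp \<Gamma> v"
  using assms by (auto simp: edges_def place_edges_def doubleton_eq_iff)

lemma joinable_trichotomy:
  assumes "u \<in> places \<Gamma>" "v \<in> places \<Gamma>" "a \<in> places \<Gamma>" "joinable \<Gamma> a b" "b \<in> places \<Gamma>"
  shows "joinable \<Gamma> u v \<or> (joinable \<Gamma> u a \<and> joinable \<Gamma> a v) \<or> (joinable \<Gamma> u b \<and> joinable \<Gamma> b v)"
  using assms by (auto simp: places_def)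

lemma connected_iff:
  assumes "is_graph \<Gamma>" "u \<in> vertices \<Gamma>" "v \<in> vertices \<Gamma>"
  shows "(u, v) \<in> {(a, b). {a, b} \<in> edges \<Gamma>}\<^sup>* \<longleftrightarrow> vcomp \<Gamma> u = vcomp \<Gamma> v"
    (is "_ \<in> ?R\<^sup>* \<longleftrightarrow> _")
proof
  assume "(u, v) \<in> ?R\<^sup>*"
  then show "vcomp \<Gamma> u = vcomp \<Gamma> v"
    by (induction rule: rtrancl_induct) (auto dest: vcomp_edge)
next
  assume eq: "vcomp \<Gamma> u = vcomp \<Gamma> v"
  have pe: "(a, b) \<in> ?R" if "a \<in> places \<Gamma>" "b \<in> places \<Gamma>" "vcomp \<Gamma> a = vcomp \<Gamma> b"
      "joinable \<Gamma> a b" for a b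
    using that by (auto simp: edges_def place_edges_def)
  show "(u, v) \<in> ?R\<^sup>*"
  proof (cases "vcomp \<Gamma> u \<in> gcomps \<Gamma>")
    case True
    let ?g = "GV (vcomp \<Gamma> u)"
    have "(w, ?g) \<in> ?R\<^sup>* \<and> (?g, w) \<in> ?R\<^sup>*" if "w \<in> vertices \<Gamma>" "vcomp \<Gamma> w = vcomp \<Gamma> u" for w
    proof (cases "w \<in> places \<Gamma>")
      case w: True
      have "{w, ?g} \<in> edges \<Gamma>" using w True that unfolding edges_def by blast
      then have "(w, ?g) \<in> ?R" "(?g, w) \<in> ?R" by (auto simp: insert_commute)
      then show ?thesis by blast
    next
      case False
      then have "w = ?g" using that by (auto simp: vertices_def)
      then show ?thesis by simp
    qed
    from this[OF assms(2)] this[OF assms(3)] eq show ?thesis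
      by (auto intro: rtrancl_trans)
  next
    case False
    then have uv: "u \<in> places \<Gamma>" "v \<in> places \<Gamma>"
      using assms eq by (auto simp: vertices_def)
    then have "vcomp \<Gamma> u < ncomp \<Gamma>"
      using assms(1) by (auto simp: places_def is_graph_def subset_iff)
    with False obtain a b where ab: "a \<in> places \<Gamma>" "b \<in> places \<Gamma>" "vcomp \<Gamma> a = vcomp \<Gamma> u"
        "vcomp \<Gamma> b = vcomp \<Gamma> u" "joinable \<Gamma> a b"
      by (auto simp: gcomps_def place_edges_def)
    from joinable_trichotomy[OF uv ab(1) ab(5) ab(2)] show ?thesis
    proof (elim disjE conjE)
      assume "joinable \<Gamma> u v"
      then show ?thesis using pe[OF uv eq] by blast
    next
      assume "joinable \<Gamma> u a" "joinable \<Gamma> a v"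
      then have "(u, a) \<in> ?R" "(a, v) \<in> ?R"
        using pe[OF uv(1) ab(1)] pe[OF ab(1) uv(2)] ab eq by simp_all
      then show ?thesis by (rule converse_rtrancl_into_rtrancl[OF _ r_into_rtrancl])
    next
      assume "joinable \<Gamma> u b" "joinable \<Gamma> b v"
      then have "(u, b) \<in> ?R" "(b, v) \<in> ?R"
        using pe[OF uv(1) ab(2)] pe[OF ab(2) uv(2)] ab eq by simp_all
      then show ?thesis by (rule converse_rtrancl_into_rtrancl[OF _ r_into_rtrancl])
    qed
  qed
qed

lemma vcomp_vertices:
  assumes "is_graph \<Gamma>"
  shows "vcomp \<Gamma> ` vertices \<Gamma> = {..<ncomp \<Gamma>}"
proof (intro equalityI subsetI)
  fix c assume "c \<in> vcomp \<Gamma> ` vertices \<Gamma>"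
  then show "c \<in> {..<ncomp \<Gamma>}"
    using assms by (auto simp: vertices_def places_def gcomps_def is_graph_def subset_iff)
next
  fix c assume c: "c \<in> {..<ncomp \<Gamma>}"
  show "c \<in> vcomp \<Gamma> ` vertices \<Gamma>"
  proof (cases "c \<in> gcomps \<Gamma>")
    case True
    then have "GV c \<in> vertices \<Gamma>" by (simp add: vertices_def)
    then show ?thesis by force
  next
    case False
    then show ?thesis using c by (auto simp: gcomps_def place_edges_def vertices_def)
  qed
qed

subsection \<open>Operations on graphs\<close>

definition relabel :: "graph \<Rightarrow> (nat \<Rightarrow> nat) \<Rightarrow> nat \<Rightarrow> graph" where
  "relabel \<Gamma> r k = \<Gamma>\<lparr>ncomp := k, lcomp := map r (lcomp \<Gamma>), rcomp := map r (rcomp \<Gamma>)\<rparr>"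

definition inverted :: "graph \<Rightarrow> graph" where
  "inverted \<Gamma> = \<lparr>lsign = map Not (rsign \<Gamma>), rsign = map Not (lsign \<Gamma>), ncomp = ncomp \<Gamma>,
     lcomp = rcomp \<Gamma>, rcomp = lcomp \<Gamma>\<rparr>"

definition disjoint_union :: "graph \<Rightarrow> graph \<Rightarrow> graph" where
  "disjoint_union \<Phi> \<Psi> = \<lparr>lsign = lsign \<Phi> @ lsign \<Psi>, rsign = rsign \<Phi> @ rsign \<Psi>,
     ncomp = ncomp \<Phi> + ncomp \<Psi>,
     lcomp = lcomp \<Phi> @ map (\<lambda>c. ncomp \<Phi> + c) (lcomp \<Psi>),
     rcomp = rcomp \<Phi> @ map (\<lambda>c. ncomp \<Phi> + c) (rcomp \<Psi>)\<rparr>"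

text \<open>\<open>r\<close> numbers, by \<open>0, \<dots>, k - 1\<close>, the components that result when the components in \<open>I\<close>
  of a graph with \<open>n\<close> components are merged.  No particular order of the new components is imposed;
  with \<open>I\<close> a singleton, \<open>r\<close> merely renumbers.\<close>

definition merging :: "nat \<Rightarrow> nat set \<Rightarrow> (nat \<Rightarrow> nat) \<Rightarrow> nat \<Rightarrow> bool" where
  "merging n I r k \<longleftrightarrow> I \<noteq> {} \<and> I \<subseteq> {..<n} \<and> r ` {..<n} = {..<k} \<and>
     (\<forall>i < n. \<forall>j < n. r i = r j \<longleftrightarrow> i = j \<or> (i \<in> I \<and> j \<in> I))"

text \<open>Since the components of \<open>\<Phi>\<close> and of \<open>\<Psi>\<close> are connected, those of \<open>\<Phi> + \<Psi>\<close> are the classes of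
  components of \<open>\<Phi>\<close> (tagged \<open>Inl\<close>) and of \<open>\<Psi>\<close> (tagged \<open>Inr\<close>) under the equivalence relation that
  is generated by sharing a place \<open>y\<^sub>j\<close>.  The functions \<open>\<rho>\<close> and \<open>\<sigma>\<close> number these classes, in any
  order, by \<open>0, \<dots>, k - 1\<close>.\<close>

definition shared :: "graph \<Rightarrow> graph \<Rightarrow> ((nat + nat) \<times> (nat + nat)) set" where
  "shared \<Phi> \<Psi> = {(Inl (rcomp \<Phi> ! j), Inr (lcomp \<Psi> ! j)) | j. j < length (rsign \<Phi>)}"

definition glueing ::
    "graph \<Rightarrow> graph \<Rightarrow> (nat \<Rightarrow> nat) \<Rightarrow> (nat \<Rightarrow> nat) \<Rightarrow> nat \<Rightarrow> bool" where
  "glueing \<Phi> \<Psi> \<rho> \<sigma> k \<longleftrightarrow> (let V = {..<ncomp \<Phi>} <+> {..<ncomp \<Psi>} in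
     case_sum \<rho> \<sigma> ` V = {..<k} \<and>
     (\<forall>u \<in> V. \<forall>v \<in> V. case_sum \<rho> \<sigma> u = case_sum \<rho> \<sigma> v \<longleftrightarrow>
        (u, v) \<in> (shared \<Phi> \<Psi> \<union> (shared \<Phi> \<Psi>)\<inverse>)\<^sup>*))"

definition composite :: "graph \<Rightarrow> graph \<Rightarrow> (nat \<Rightarrow> nat) \<Rightarrow> (nat \<Rightarrow> nat) \<Rightarrow> nat \<Rightarrow> graph" where
  "composite \<Phi> \<Psi> \<rho> \<sigma> k = \<lparr>lsign = lsign \<Phi>, rsign = rsign \<Psi>, ncomp = k,
     lcomp = map \<rho> (lcomp \<Phi>), rcomp = map \<sigma> (rcomp \<Psi>)\<rparr>"

section \<open>g-dinatural transformations\<close>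

text \<open>\<open>reindex As cs\<close> is the tuple whose \<open>j\<close>-th entry is \<open>A\<^bsub>cs ! j\<^esub>\<close>.\<close>

definition reindex :: "'o list \<Rightarrow> nat list \<Rightarrow> 'o list" where
  "reindex As cs = map (\<lambda>c. As ! c) cs"

definition is_family ::
    "('o, 'm) bcc \<Rightarrow> ('o, 'm) mfunctor \<Rightarrow> ('o, 'm) mfunctor \<Rightarrow> graph \<Rightarrow> ('o list \<Rightarrow> 'm) \<Rightarrow> bool" where
  "is_family B T S \<Gamma> \<alpha> \<longleftrightarrow> (\<forall>As \<in> obs B (ncomp \<Gamma>).
     \<alpha> As \<in> hom B (omap T (reindex As (lcomp \<Gamma>))) (omap S (reindex As (rcomp \<Gamma>))))"

text \<open>The tuple of arrows, for argument places with signs \<open>ss\<close> in the components \<open>cs\<close>, that has \<open>p\<close>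
  at the positive and \<open>q\<close> at the negative places of component \<open>i\<close> and identities elsewhere.\<close>

definition place_arrows ::
    "('o, 'm) bcc \<Rightarrow> 'o list \<Rightarrow> nat \<Rightarrow> bool list \<Rightarrow> nat list \<Rightarrow> 'm \<Rightarrow> 'm \<Rightarrow> 'm list" where
  "place_arrows B As i ss cs p q =
     map2 (\<lambda>s c. if c \<noteq> i then Id B (As ! c) else if s then p else q) ss cs"

definition g_dinatural ::
    "('o, 'm) bcc \<Rightarrow> ('o, 'm) mfunctor \<Rightarrow> ('o, 'm) mfunctor \<Rightarrow> graph \<Rightarrow> ('o list \<Rightarrow> 'm) \<Rightarrow> bool" where
  "g_dinatural B T S \<Gamma> \<alpha> \<longleftrightarrow>
     is_functor B T \<and> is_functor B S \<and>
     is_graph \<Gamma> \<and> lsign \<Gamma> = signs T \<and> rsign \<Gamma> = signs S \<and> is_family B T S \<Gamma> \<alpha> \<and>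
     (\<forall>i < ncomp \<Gamma>. \<forall>As \<in> obs B (ncomp \<Gamma>). \<forall>A C. \<forall>f \<in> hom B A C.
        let v  = place_arrows B As i (lsign \<Gamma>) (lcomp \<Gamma>) f (Id B C);
            v' = place_arrows B As i (lsign \<Gamma>) (lcomp \<Gamma>) (Id B A) f;
            u  = place_arrows B As i (rsign \<Gamma>) (rcomp \<Gamma>) (Id B C) f;
            u' = place_arrows B As i (rsign \<Gamma>) (rcomp \<Gamma>) f (Id B A)
        in Comp B (amap S u) (Comp B (\<alpha> (As[i := C])) (amap T v))
             = Comp B (amap S u') (Comp B (\<alpha> (As[i := A])) (amap T v')))"

section \<open>Canonical transformations\<close>

text \<open>Families are functions restricted to the tuples of objects of the appropriate length, so that
  equality of families is equality of functions.  In a primitive transformation the components are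
  numbered by the argument places of \<open>F\<close>, then of \<open>G\<close>, then of \<open>H\<close>.\<close>

definition family1 :: "('o, 'm) bcc \<Rightarrow> ('o \<Rightarrow> 'm) \<Rightarrow> fob \<Rightarrow> 'o list \<Rightarrow> 'm" where
  "family1 B h F = (\<lambda>As \<in> obs B (ar B F). h (omap (funct B F) As))"

definition family2 :: "('o, 'm) bcc \<Rightarrow> ('o \<Rightarrow> 'o \<Rightarrow> 'm) \<Rightarrow> fob \<Rightarrow> fob \<Rightarrow> 'o list \<Rightarrow> 'm" where
  "family2 B h F G = (\<lambda>As \<in> obs B (ar B F + ar B G).
     h (omap (funct B F) (take (ar B F) As)) (omap (funct B G) (drop (ar B F) As)))"

definition family3 ::
    "('o, 'm) bcc \<Rightarrow> ('o \<Rightarrow> 'o \<Rightarrow> 'o \<Rightarrow> 'm) \<Rightarrow> fob \<Rightarrow> fob \<Rightarrow> fob \<Rightarrow> 'o list \<Rightarrow> 'm" where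
  "family3 B h F G H = (\<lambda>As \<in> obs B (ar B F + ar B G + ar B H).
     h (omap (funct B F) (take (ar B F) As))
       (omap (funct B G) (take (ar B G) (drop (ar B F) As)))
       (omap (funct B H) (drop (ar B F + ar B G) As)))"

definition fgraph :: "('o, 'm) bcc \<Rightarrow> fob \<Rightarrow> fob \<Rightarrow> nat \<Rightarrow> nat list \<Rightarrow> nat list \<Rightarrow> graph" where
  "fgraph B F G k ls rs =
     \<lparr>lsign = sg B F, rsign = sg B G, ncomp = k, lcomp = ls, rcomp = rs\<rparr>"

text \<open>The components of the argument places of the first, second and third index.\<close>

abbreviation pl1 :: "('o, 'm) bcc \<Rightarrow> fob \<Rightarrow> nat list" where
  "pl1 B F \<equiv> [0..<ar B F]"

abbreviation pl2 :: "('o, 'm) bcc \<Rightarrow> fob \<Rightarrow> fob \<Rightarrow> nat list" where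
  "pl2 B F G \<equiv> [ar B F..<ar B F + ar B G]"

abbreviation pl3 :: "('o, 'm) bcc \<Rightarrow> fob \<Rightarrow> fob \<Rightarrow> fob \<Rightarrow> nat list" where
  "pl3 B F G H \<equiv> [ar B F + ar B G..<ar B F + ar B G + ar B H]"

inductive canonical :: "('o, 'm) bcc \<Rightarrow> fob \<Rightarrow> fob \<Rightarrow> graph \<Rightarrow> ('o list \<Rightarrow> 'm) \<Rightarrow> bool"
  for B :: "('o, 'm) bcc" where
  ident: "canonical B F F (fgraph B F F (ar B F) (pl1 B F) (pl1 B F)) (family1 B (Id B) F)"
| delta: "canonical B (F \<^bold>\<otimes> One) F
    (fgraph B (F \<^bold>\<otimes> One) F (ar B F) (pl1 B F) (pl1 B F)) (family1 B (sp_delta B) F)"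
| delta_inv: "canonical B F (F \<^bold>\<otimes> One)
    (fgraph B F (F \<^bold>\<otimes> One) (ar B F) (pl1 B F) (pl1 B F)) (family1 B (sp_delta_inv B) F)"
| b_right: "canonical B (F \<^bold>\<otimes> (G \<^bold>\<otimes> H)) ((F \<^bold>\<otimes> G) \<^bold>\<otimes> H)
    (fgraph B (F \<^bold>\<otimes> (G \<^bold>\<otimes> H)) ((F \<^bold>\<otimes> G) \<^bold>\<otimes> H) (ar B F + ar B G + ar B H)
      (pl1 B F @ pl2 B F G @ pl3 B F G H) (pl1 B F @ pl2 B F G @ pl3 B F G H))
    (family3 B (sp_b_right B) F G H)"
| b_left: "canonical B ((F \<^bold>\<otimes> G) \<^bold>\<otimes> H) (F \<^bold>\<otimes> (G \<^bold>\<otimes> H))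
    (fgraph B ((F \<^bold>\<otimes> G) \<^bold>\<otimes> H) (F \<^bold>\<otimes> (G \<^bold>\<otimes> H)) (ar B F + ar B G + ar B H)
      (pl1 B F @ pl2 B F G @ pl3 B F G H) (pl1 B F @ pl2 B F G @ pl3 B F G H))
    (family3 B (sp_b_left B) F G H)"
| symm: "canonical B (F \<^bold>\<otimes> G) (G \<^bold>\<otimes> F)
    (fgraph B (F \<^bold>\<otimes> G) (G \<^bold>\<otimes> F) (ar B F + ar B G)
      (pl1 B F @ pl2 B F G) (pl2 B F G @ pl1 B F))
    (family2 B (sp_c B) F G)"
| diag: "canonical B F (F \<^bold>\<otimes> F)
    (fgraph B F (F \<^bold>\<otimes> F) (ar B F) (pl1 B F) (pl1 B F @ pl1 B F)) (family1 B (sp_w B) F)"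
| terminal: "canonical B F One
    (fgraph B F One (ar B F) (pl1 B F) []) (family1 B (sp_k B) F)"
| initial: "canonical B Zero F
    (fgraph B Zero F (ar B F) [] (pl1 B F)) (family1 B (sp_l B) F)"
| inj1: "canonical B F (F \<^bold>\<oplus> G)
    (fgraph B F (F \<^bold>\<oplus> G) (ar B F + ar B G) (pl1 B F) (pl1 B F @ pl2 B F G))
    (family2 B (Inj1 B) F G)"
| inj2: "canonical B G (F \<^bold>\<oplus> G)
    (fgraph B G (F \<^bold>\<oplus> G) (ar B F + ar B G) (pl2 B F G) (pl1 B F @ pl2 B F G))
    (family2 B (Inj2 B) F G)"
| codiag: "canonical B (F \<^bold>\<oplus> F) F
    (fgraph B (F \<^bold>\<oplus> F) F (ar B F) (pl1 B F @ pl1 B F) (pl1 B F)) (family1 B (sp_m B) F)"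
| counit_exp: "canonical B (F \<^bold>\<otimes> (F \<^bold>\<rightarrow> G)) G
    (fgraph B (F \<^bold>\<otimes> (F \<^bold>\<rightarrow> G)) G (ar B F + ar B G)
      (pl1 B F @ pl1 B F @ pl2 B F G) (pl2 B F G))
    (family2 B (Eval B) F G)"
| unit_exp: "canonical B G (F \<^bold>\<rightarrow> (F \<^bold>\<otimes> G))
    (fgraph B G (F \<^bold>\<rightarrow> (F \<^bold>\<otimes> G)) (ar B F + ar B G)
      (pl2 B F G) (pl1 B F @ pl1 B F @ pl2 B F G))
    (family2 B (sp_eta B) F G)"
| sub: "canonical B F G \<Gamma> \<alpha> \<Longrightarrow> merging (ncomp \<Gamma>) I r k \<Longrightarrow>
    canonical B F G (relabel \<Gamma> r k)
      (\<lambda>As \<in> obs B k. \<alpha> (reindex As (map r [0..<ncomp \<Gamma>])))"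
| tensor: "canonical B F G \<Phi> \<alpha> \<Longrightarrow> canonical B H J \<Psi> \<beta> \<Longrightarrow>
    canonical B (F \<^bold>\<otimes> H) (G \<^bold>\<otimes> J) (disjoint_union \<Phi> \<Psi>)
      (\<lambda>As \<in> obs B (ncomp \<Phi> + ncomp \<Psi>).
         prod_arr B (\<alpha> (take (ncomp \<Phi>) As)) (\<beta> (drop (ncomp \<Phi>) As)))"
| oplus: "canonical B F G \<Phi> \<alpha> \<Longrightarrow> canonical B H J \<Psi> \<beta> \<Longrightarrow>
    canonical B (F \<^bold>\<oplus> H) (G \<^bold>\<oplus> J) (disjoint_union \<Phi> \<Psi>)
      (\<lambda>As \<in> obs B (ncomp \<Phi> + ncomp \<Psi>).
         coprod_arr B (\<alpha> (take (ncomp \<Phi>) As)) (\<beta> (drop (ncomp \<Phi>) As)))"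
| arrow: "canonical B F G \<Phi> \<alpha> \<Longrightarrow> canonical B H J \<Psi> \<beta> \<Longrightarrow>
    canonical B (G \<^bold>\<rightarrow> H) (F \<^bold>\<rightarrow> J) (disjoint_union (inverted \<Phi>) \<Psi>)
      (\<lambda>As \<in> obs B (ncomp \<Phi> + ncomp \<Psi>).
         exp_arr B (\<alpha> (take (ncomp \<Phi>) As)) (\<beta> (drop (ncomp \<Phi>) As)))"
| comp: "canonical B F G \<Phi> \<alpha> \<Longrightarrow> canonical B G H \<Psi> \<beta> \<Longrightarrow> glueing \<Phi> \<Psi> \<rho> \<sigma> k \<Longrightarrow>
    canonical B F H (composite \<Phi> \<Psi> \<rho> \<sigma> k)
      (\<lambda>As \<in> obs B k. Comp B (\<beta> (reindex As (map \<sigma> [0..<ncomp \<Psi>])))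
                               (\<alpha> (reindex As (map \<rho> [0..<ncomp \<Phi>]))))"

end

theory Submission
  imports Defs
begin

text \<open>Dinaturality by itself is not preserved by composition: when the arguments of two families are
  linked in a loop through the intermediate functor, the two hexagons cannot be pasted.  The proof
  therefore establishes a stronger property of canonical transformations that does compose, namely
  relational parametricity, and derives g-dinaturality from it at the end.

  A relation between objects \<open>A\<close> and \<open>C\<close> is here a relation between generalized elements
  \<open>x : D \<turnstile> A\<close> and \<open>y : D \<turnstile> C\<close> for varying \<open>D\<close>, stable under precomposition, and local with respect to
  the covers of \<open>U + V\<close> by its two injections and of the initial object by nothing (\<open>admissible\<close>).  Products,
  exponentials and coproducts of such relations are defined as for logical relations, and the
  structural morphisms preserve them; locality is what makes copairing preserve them.  Locality
  of exponentials (\<open>admissible_expR\<close>) uses that \<open>D \<times> _\<close> preserves covers, hence that products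
  distribute over coproducts (\<open>distribute\<close>).  Assigning a relation to every component of a graph
  turns each object of \<open>\<F>\<^sub>\<B>\<close> into a relation (\<open>lift\<close>), and every canonical transformation preserves
  the resulting relations (\<open>rel_family_canonical\<close>).  All that composition requires is that places that are
  glued carry the same relation, which holds because a component of the composite graph receives
  a single one; loops do no harm.

  To recover dinaturality, assign to each component the graph of an arrow \<open>f\<^sub>c : A\<^sub>c \<turnstile> C\<^sub>c\<close>.  With \<open>A\<close>
  at negative and \<open>C\<close> at positive places written \<open>F(A,C)\<close>, the lifted relation lies between two
  concrete ones (\<open>sandwiched_lift\<close>): it contains the pair of arrows \<open>F(C,A) \<turnstile> F(A,A)\<close> and
  \<open>F(C,A) \<turnstile> F(C,C)\<close> induced by the \<open>f\<^sub>c\<close>, and any related \<open>x\<close>, \<open>y\<close> become equal under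
  \<open>F(A,A) \<turnstile> F(A,C)\<close> and \<open>F(C,C) \<turnstile> F(A,C)\<close>.  For \<open>\<alpha>\<close> from \<open>F\<close> to \<open>G\<close>, start from the pair
  provided by the first fact for \<open>F\<close>, apply \<open>\<alpha>\<close> at \<open>A\<close> and at \<open>C\<close>, and use the second fact for \<open>G\<close>:
  the result is the hexagon.  Taking \<open>f\<^sub>i = f\<close> and identities elsewhere gives g-dinaturality.\<close>

section \<open>Calculus in a bicartesian closed category\<close>

context bicartesian_closed
begin

abbreviation cmp (infixr "\<cdot>" 75) where "g \<cdot> f \<equiv> Comp B g f"

lemma hom_iff: "f \<in> hom B A C \<longleftrightarrow> f \<in> Arr B \<and> Dom B f = A \<and> Cod B f = C"
  by (simp add: hom_def)

text \<open>The rewrite rules below test their side conditions by computing sources and targets.  Composition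
  is associated to the right, so the universal properties also get variants with a tail.\<close>

lemma Id_simps [simp]:
  assumes "A \<in> Ob B"
  shows "Id B A \<in> Arr B" "Dom B (Id B A) = A" "Cod B (Id B A) = A"
  using Id_hom[OF assms] by (simp_all add: hom_iff)

lemma Comp_simps [simp]:
  assumes "f \<in> Arr B" "g \<in> Arr B" "Cod B f = Dom B g"
  shows "g \<cdot> f \<in> Arr B" "Dom B (g \<cdot> f) = Dom B f" "Cod B (g \<cdot> f) = Cod B g"
  using Comp_hom[of f "Dom B f" "Cod B f" g "Cod B g"] assms by (simp_all add: hom_iff)

lemma Id_left' [simp]: "f \<in> Arr B \<Longrightarrow> Cod B f = C \<Longrightarrow> Id B C \<cdot> f = f"
  using Id_left[of f "Dom B f" C] by (simp add: hom_iff)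

lemma Id_right' [simp]: "f \<in> Arr B \<Longrightarrow> Dom B f = A \<Longrightarrow> f \<cdot> Id B A = f"
  using Id_right[of f A "Cod B f"] by (simp add: hom_iff)

lemma Comp_assoc' [simp]:
  assumes "f \<in> Arr B" "g \<in> Arr B" "h \<in> Arr B" "Cod B f = Dom B g" "Cod B g = Dom B h"
  shows "(h \<cdot> g) \<cdot> f = h \<cdot> (g \<cdot> f)"
  using Comp_assoc[of f "Dom B f" "Cod B f" g "Cod B g" h "Cod B h"] assms by (simp add: hom_iff)

lemma Ob_simps [simp]:
  "f \<in> Arr B \<Longrightarrow> Dom B f \<in> Ob B" "f \<in> Arr B \<Longrightarrow> Cod B f \<in> Ob B"
  "A \<in> Ob B \<Longrightarrow> C \<in> Ob B \<Longrightarrow> Prod B A C \<in> Ob B"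
  "A \<in> Ob B \<Longrightarrow> C \<in> Ob B \<Longrightarrow> Coprod B A C \<in> Ob B"
  "A \<in> Ob B \<Longrightarrow> C \<in> Ob B \<Longrightarrow> Exp B A C \<in> Ob B"
  "Term B \<in> Ob B" "Init B \<in> Ob B"
  by (auto intro: Dom_Ob Cod_Ob Prod_Ob Coprod_Ob Exp_Ob Term_Ob Init_Ob)

lemma structure_simps [simp]:
  assumes "A \<in> Ob B" "C \<in> Ob B"
  shows "Proj1 B A C \<in> Arr B" "Dom B (Proj1 B A C) = Prod B A C" "Cod B (Proj1 B A C) = A"
    "Proj2 B A C \<in> Arr B" "Dom B (Proj2 B A C) = Prod B A C" "Cod B (Proj2 B A C) = C"
    "Inj1 B A C \<in> Arr B" "Dom B (Inj1 B A C) = A" "Cod B (Inj1 B A C) = Coprod B A C"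
    "Inj2 B A C \<in> Arr B" "Dom B (Inj2 B A C) = C" "Cod B (Inj2 B A C) = Coprod B A C"
    "Eval B A C \<in> Arr B" "Dom B (Eval B A C) = Prod B A (Exp B A C)" "Cod B (Eval B A C) = C"
  using Proj1_hom[OF assms] Proj2_hom[OF assms] Inj1_hom[OF assms] Inj2_hom[OF assms]
    Eval_hom[OF assms] by (simp_all add: hom_iff)

lemma pair_props:
  assumes "f \<in> Arr B" "g \<in> Arr B" "Dom B f = Dom B g"
  shows "pair B f g \<in> hom B (Dom B f) (Prod B (Cod B f) (Cod B g)) \<and>
    Proj1 B (Cod B f) (Cod B g) \<cdot> pair B f g = f \<and> Proj2 B (Cod B f) (Cod B g) \<cdot> pair B f g = g"
  unfolding pair_def
  by (rule theI', rule Prod_universal) (use assms in \<open>simp_all add: hom_iff\<close>)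

lemma pair_simps [simp]:
  assumes "f \<in> Arr B" "g \<in> Arr B" "Dom B f = Dom B g"
  shows "pair B f g \<in> Arr B" "Dom B (pair B f g) = Dom B g"
    "Cod B (pair B f g) = Prod B (Cod B f) (Cod B g)"
    "Cod B f = A \<Longrightarrow> Cod B g = C \<Longrightarrow> Proj1 B A C \<cdot> pair B f g = f"
    "Cod B f = A \<Longrightarrow> Cod B g = C \<Longrightarrow> Proj2 B A C \<cdot> pair B f g = g"
  using pair_props[OF assms] assms by (auto simp: hom_iff)

lemma pair_simps_tail [simp]:
  assumes "f \<in> Arr B" "g \<in> Arr B" "Dom B f = Dom B g" "Cod B f = A" "Cod B g = C"
    "h \<in> Arr B" "Cod B h = Dom B g"
  shows "Proj1 B A C \<cdot> (pair B f g \<cdot> h) = f \<cdot> h" "Proj2 B A C \<cdot> (pair B f g \<cdot> h) = g \<cdot> h"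
  using assms by (auto simp flip: Comp_assoc')

lemma pair_eqI:
  assumes "h \<in> Arr B" "h' \<in> Arr B" "Dom B h = Dom B h'" "Cod B h = Prod B A C" "Cod B h' = Prod B A C"
    "A \<in> Ob B" "C \<in> Ob B"
    "Proj1 B A C \<cdot> h = Proj1 B A C \<cdot> h'" "Proj2 B A C \<cdot> h = Proj2 B A C \<cdot> h'"
  shows "h = h'"
proof -
  have "\<exists>!k. k \<in> hom B (Dom B h) (Prod B A C) \<and> Proj1 B A C \<cdot> k = Proj1 B A C \<cdot> h \<and>
      Proj2 B A C \<cdot> k = Proj2 B A C \<cdot> h"
    using assms by (intro Prod_universal) (simp_all add: hom_iff)
  moreover have "h \<in> hom B (Dom B h) (Prod B A C)" "h' \<in> hom B (Dom B h) (Prod B A C)"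
    using assms by (simp_all add: hom_iff)
  ultimately show ?thesis using assms by metis
qed

lemma pair_comp [simp]:
  assumes "f \<in> Arr B" "g \<in> Arr B" "Dom B f = Dom B g" "h \<in> Arr B" "Cod B h = Dom B g"
  shows "pair B f g \<cdot> h = pair B (f \<cdot> h) (g \<cdot> h)"
  by (rule pair_eqI[where A = "Cod B f" and C = "Cod B g"]) (use assms in simp_all)

lemma pair_Proj [simp]:
  assumes "A \<in> Ob B" "C \<in> Ob B"
  shows "pair B (Proj1 B A C) (Proj2 B A C) = Id B (Prod B A C)"
  by (rule pair_eqI[where A = A and C = C]) (use assms in simp_all)

lemma pair_Proj_comp [simp]:
  assumes "A \<in> Ob B" "C \<in> Ob B" "h \<in> Arr B" "Cod B h = Prod B A C"
  shows "pair B (Proj1 B A C \<cdot> h) (Proj2 B A C \<cdot> h) = h"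
  by (rule pair_eqI[where A = A and C = C]) (use assms in simp_all)

lemma prod_arr_simps [simp]:
  assumes "f \<in> Arr B" "g \<in> Arr B"
  shows "prod_arr B f g \<in> Arr B" "Dom B (prod_arr B f g) = Prod B (Dom B f) (Dom B g)"
    "Cod B (prod_arr B f g) = Prod B (Cod B f) (Cod B g)"
  using assms by (simp_all add: prod_arr_def)

lemma copair_props:
  assumes "f \<in> Arr B" "g \<in> Arr B" "Cod B f = Cod B g"
  shows "copair B f g \<in> hom B (Coprod B (Dom B f) (Dom B g)) (Cod B f) \<and>
    copair B f g \<cdot> Inj1 B (Dom B f) (Dom B g) = f \<and> copair B f g \<cdot> Inj2 B (Dom B f) (Dom B g) = g"
  unfolding copair_def
  by (rule theI', rule Coprod_universal) (use assms in \<open>simp_all add: hom_iff\<close>)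

lemma copair_simps [simp]:
  assumes "f \<in> Arr B" "g \<in> Arr B" "Cod B f = Cod B g"
  shows "copair B f g \<in> Arr B" "Dom B (copair B f g) = Coprod B (Dom B f) (Dom B g)"
    "Cod B (copair B f g) = Cod B g"
    "Dom B f = A \<Longrightarrow> Dom B g = C \<Longrightarrow> copair B f g \<cdot> Inj1 B A C = f"
    "Dom B f = A \<Longrightarrow> Dom B g = C \<Longrightarrow> copair B f g \<cdot> Inj2 B A C = g"
  using copair_props[OF assms] assms by (auto simp: hom_iff)

lemma copair_simps_tail [simp]:
  assumes "f \<in> Arr B" "g \<in> Arr B" "Cod B f = Cod B g" "Dom B f = A" "Dom B g = C" "h \<in> Arr B"
  shows "Cod B h = A \<Longrightarrow> copair B f g \<cdot> (Inj1 B A C \<cdot> h) = f \<cdot> h"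
    "Cod B h = C \<Longrightarrow> copair B f g \<cdot> (Inj2 B A C \<cdot> h) = g \<cdot> h"
  using assms by (auto simp flip: Comp_assoc')

lemma copair_eqI:
  assumes "h \<in> Arr B" "h' \<in> Arr B" "Cod B h = Cod B h'"
    "Dom B h = Coprod B A C" "Dom B h' = Coprod B A C" "A \<in> Ob B" "C \<in> Ob B"
    "h \<cdot> Inj1 B A C = h' \<cdot> Inj1 B A C" "h \<cdot> Inj2 B A C = h' \<cdot> Inj2 B A C"
  shows "h = h'"
proof -
  have "\<exists>!k. k \<in> hom B (Coprod B A C) (Cod B h) \<and> k \<cdot> Inj1 B A C = h \<cdot> Inj1 B A C \<and>
      k \<cdot> Inj2 B A C = h \<cdot> Inj2 B A C"
    using assms by (intro Coprod_universal) (simp_all add: hom_iff)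
  moreover have "h \<in> hom B (Coprod B A C) (Cod B h)" "h' \<in> hom B (Coprod B A C) (Cod B h)"
    using assms by (simp_all add: hom_iff)
  ultimately show ?thesis using assms by metis
qed

lemma coprod_arr_simps [simp]:
  assumes "f \<in> Arr B" "g \<in> Arr B"
  shows "coprod_arr B f g \<in> Arr B" "Dom B (coprod_arr B f g) = Coprod B (Dom B f) (Dom B g)"
    "Cod B (coprod_arr B f g) = Coprod B (Cod B f) (Cod B g)"
  using assms by (simp_all add: coprod_arr_def)

lemma sp_k_simps [simp]:
  assumes "A \<in> Ob B"
  shows "sp_k B A \<in> Arr B" "Dom B (sp_k B A) = A" "Cod B (sp_k B A) = Term B"
  using theI'[OF Term_universal[OF assms]] by (simp_all add: sp_k_def hom_iff)

lemma sp_l_simps [simp]: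
  assumes "A \<in> Ob B"
  shows "sp_l B A \<in> Arr B" "Dom B (sp_l B A) = Init B" "Cod B (sp_l B A) = A"
  using theI'[OF Init_universal[OF assms]] by (simp_all add: sp_l_def hom_iff)

lemma init_eqI:
  assumes "f \<in> Arr B" "g \<in> Arr B" "Dom B f = Init B" "Dom B g = Init B" "Cod B f = Cod B g"
  shows "f = g"
  using Init_universal[of "Cod B f"] assms by (auto simp: hom_iff)

lemma curry_props:
  assumes "f \<in> Arr B" "Dom B f = Prod B A D" "A \<in> Ob B" "D \<in> Ob B"
  shows "curry B A D f \<in> hom B D (Exp B A (Cod B f)) \<and>
    Eval B A (Cod B f) \<cdot> prod_arr B (Id B A) (curry B A D f) = f"
  unfolding curry_def
  by (rule theI', rule Exp_universal) (use assms in \<open>simp_all add: hom_iff\<close>)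

lemma curry_simps [simp]:
  assumes "f \<in> Arr B" "Dom B f = Prod B A D" "A \<in> Ob B" "D \<in> Ob B"
  shows "curry B A D f \<in> Arr B" "Dom B (curry B A D f) = D"
    "Cod B (curry B A D f) = Exp B A (Cod B f)"
  using curry_props[OF assms] by (simp_all add: hom_iff)

lemma Eval_curry_comp [simp]:
  assumes "f \<in> Arr B" "Dom B f = Prod B A D" "Cod B f = C" "A \<in> Ob B" "D \<in> Ob B"
    "a \<in> Arr B" "d \<in> Arr B" "Dom B a = Dom B d" "Cod B a = A" "Cod B d = D"
  shows "Eval B A C \<cdot> pair B a (curry B A D f \<cdot> d) = f \<cdot> pair B a d"
proof -
  have "Eval B A C \<cdot> pair B a (curry B A D f \<cdot> d) =
      Eval B A C \<cdot> prod_arr B (Id B A) (curry B A D f) \<cdot> pair B a d"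
    using assms by (simp add: prod_arr_def)
  also have "\<dots> = (Eval B A C \<cdot> prod_arr B (Id B A) (curry B A D f)) \<cdot> pair B a d"
    using assms by (intro Comp_assoc'[symmetric]) auto
  also have "\<dots> = f \<cdot> pair B a d"
    using curry_props[of f A D] assms by simp
  finally show ?thesis .
qed

lemma exp_eqI:
  assumes "g \<in> Arr B" "g' \<in> Arr B" "Dom B g = Dom B g'" "Cod B g = Exp B A C" "Cod B g' = Exp B A C"
    "A \<in> Ob B" "C \<in> Ob B"
    "Eval B A C \<cdot> prod_arr B (Id B A) g = Eval B A C \<cdot> prod_arr B (Id B A) g'"
  shows "g = g'"
proof -
  have "\<exists>!k. k \<in> hom B (Dom B g) (Exp B A C) \<and>
      Eval B A C \<cdot> prod_arr B (Id B A) k = Eval B A C \<cdot> prod_arr B (Id B A) g"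
    using assms by (intro Exp_universal) (simp_all add: hom_iff)
  then show ?thesis using assms by (auto simp: hom_iff)
qed

lemma exp_arr_simps [simp]:
  assumes "f \<in> Arr B" "g \<in> Arr B"
  shows "exp_arr B f g \<in> Arr B" "Dom B (exp_arr B f g) = Exp B (Cod B f) (Dom B g)"
    "Cod B (exp_arr B f g) = Exp B (Dom B f) (Cod B g)"
  using assms by (simp_all add: exp_arr_def Let_def)

text \<open>The exponential of two arrows is characterized by evaluation at a generalized element; this
  spares later proofs the transpose that defines it.\<close>

lemma Eval_exp_arr:
  assumes "f \<in> Arr B" "g \<in> Arr B" "a \<in> Arr B" "d \<in> Arr B" "Dom B a = Dom B d"
    "Cod B a = Dom B f" "Cod B d = Exp B (Cod B f) (Dom B g)" "A = Dom B f" "C = Cod B g"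
  shows "Eval B A C \<cdot> pair B a (exp_arr B f g \<cdot> d) =
    g \<cdot> Eval B (Cod B f) (Dom B g) \<cdot> pair B (f \<cdot> a) d"
  using assms by (simp add: exp_arr_def Let_def prod_arr_def)

lemma prod_arr_Id: "A \<in> Ob B \<Longrightarrow> C \<in> Ob B \<Longrightarrow> prod_arr B (Id B A) (Id B C) = Id B (Prod B A C)"
  by (simp add: prod_arr_def)

lemma prod_arr_Comp:
  assumes "f \<in> Arr B" "g \<in> Arr B" "Cod B f = Dom B g" "f' \<in> Arr B" "g' \<in> Arr B" "Cod B f' = Dom B g'"
  shows "prod_arr B (g \<cdot> f) (g' \<cdot> f') = prod_arr B g g' \<cdot> prod_arr B f f'"
  using assms by (simp add: prod_arr_def)

lemma coprod_arr_Id: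
  "A \<in> Ob B \<Longrightarrow> C \<in> Ob B \<Longrightarrow> coprod_arr B (Id B A) (Id B C) = Id B (Coprod B A C)"
  unfolding coprod_arr_def by (rule copair_eqI[where A = A and C = C]) simp_all

lemma coprod_arr_Comp:
  assumes "f \<in> Arr B" "g \<in> Arr B" "Cod B f = Dom B g" "f' \<in> Arr B" "g' \<in> Arr B" "Cod B f' = Dom B g'"
  shows "coprod_arr B (g \<cdot> f) (g' \<cdot> f') = coprod_arr B g g' \<cdot> coprod_arr B f f'"
  unfolding coprod_arr_def
  by (rule copair_eqI[where A = "Dom B f" and C = "Dom B f'"]) (use assms in simp_all)

lemma exp_arr_Id:
  "A \<in> Ob B \<Longrightarrow> C \<in> Ob B \<Longrightarrow> exp_arr B (Id B A) (Id B C) = Id B (Exp B A C)"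
  by (rule exp_eqI[where A = A and C = C]) (simp_all add: prod_arr_def Eval_exp_arr)

lemma exp_arr_Comp:
  assumes "f \<in> Arr B" "g \<in> Arr B" "Cod B f = Dom B g" "f' \<in> Arr B" "g' \<in> Arr B" "Cod B f' = Dom B g'"
  shows "exp_arr B (g \<cdot> f) (g' \<cdot> f') = exp_arr B f g' \<cdot> exp_arr B g f'"
  by (rule exp_eqI[where A = "Dom B f" and C = "Cod B g'"])
    (use assms in \<open>simp_all add: prod_arr_def Eval_exp_arr\<close>)

end

section \<open>Logical relations\<close>

record ('o, 'm) lrel =
  Left :: "'o"
  Right :: "'o"
  Rel :: "'o \<Rightarrow> 'm \<Rightarrow> 'm \<Rightarrow> bool"

context bicartesian_closed
begin

text \<open>The last two conditions allow a relation to be checked on a cover: of \<open>U + V\<close> by its injections, of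
  the initial object by the empty family.  They are what a case distinction on an element of a
  coproduct needs in order to end in \<open>R\<close>.\<close>

definition admissible :: "('o, 'm) lrel \<Rightarrow> bool" where
  "admissible R \<longleftrightarrow> Left R \<in> Ob B \<and> Right R \<in> Ob B \<and>
     (\<forall>D x y. Rel R D x y \<longrightarrow> x \<in> hom B D (Left R) \<and> y \<in> hom B D (Right R)) \<and>
     (\<forall>D x y e. Rel R D x y \<longrightarrow> e \<in> Arr B \<longrightarrow> Cod B e = D \<longrightarrow> Rel R (Dom B e) (x \<cdot> e) (y \<cdot> e)) \<and>
     (\<forall>U V x y. U \<in> Ob B \<longrightarrow> V \<in> Ob B \<longrightarrow>
        x \<in> hom B (Coprod B U V) (Left R) \<longrightarrow> y \<in> hom B (Coprod B U V) (Right R) \<longrightarrow>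
        Rel R U (x \<cdot> Inj1 B U V) (y \<cdot> Inj1 B U V) \<longrightarrow>
        Rel R V (x \<cdot> Inj2 B U V) (y \<cdot> Inj2 B U V) \<longrightarrow> Rel R (Coprod B U V) x y) \<and>
     (\<forall>x y. x \<in> hom B (Init B) (Left R) \<longrightarrow> y \<in> hom B (Init B) (Right R) \<longrightarrow> Rel R (Init B) x y)"

lemma admissibleI:
  assumes "Left R \<in> Ob B" "Right R \<in> Ob B"
    and "\<And>D x y. Rel R D x y \<Longrightarrow> x \<in> hom B D (Left R) \<and> y \<in> hom B D (Right R)"
    and "\<And>D x y e. Rel R D x y \<Longrightarrow> e \<in> Arr B \<Longrightarrow> Cod B e = D \<Longrightarrow> Rel R (Dom B e) (x \<cdot> e) (y \<cdot> e)"
    and "\<And>U V x y. U \<in> Ob B \<Longrightarrow> V \<in> Ob B \<Longrightarrow>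
      x \<in> hom B (Coprod B U V) (Left R) \<Longrightarrow> y \<in> hom B (Coprod B U V) (Right R) \<Longrightarrow>
      Rel R U (x \<cdot> Inj1 B U V) (y \<cdot> Inj1 B U V) \<Longrightarrow>
      Rel R V (x \<cdot> Inj2 B U V) (y \<cdot> Inj2 B U V) \<Longrightarrow> Rel R (Coprod B U V) x y"
    and "\<And>x y. x \<in> hom B (Init B) (Left R) \<Longrightarrow> y \<in> hom B (Init B) (Right R) \<Longrightarrow> Rel R (Init B) x y"
  shows "admissible R"
  unfolding admissible_def using assms by blast

lemma admissible_Ob [simp]:
  assumes "admissible R"
  shows "Left R \<in> Ob B" "Right R \<in> Ob B"
  using assms by (simp_all add: admissible_def)

lemma admissible_hom:
  assumes "admissible R" "Rel R D x y"
  shows "x \<in> Arr B" "Dom B x = D" "Cod B x = Left R" "y \<in> Arr B" "Dom B y = D" "Cod B y = Right R" "D \<in> Ob B"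
proof -
  have "x \<in> hom B D (Left R)" "y \<in> hom B D (Right R)" using assms unfolding admissible_def by blast+
  then show "x \<in> Arr B" "Dom B x = D" "Cod B x = Left R" "y \<in> Arr B" "Dom B y = D" "Cod B y = Right R" "D \<in> Ob B"
    by (auto simp: hom_iff)
qed

lemma admissible_restrict:
  "admissible R \<Longrightarrow> Rel R D x y \<Longrightarrow> e \<in> Arr B \<Longrightarrow> Cod B e = D \<Longrightarrow> D' = Dom B e \<Longrightarrow> Rel R D' (x \<cdot> e) (y \<cdot> e)"
  unfolding admissible_def by blast

lemma admissible_Coprod:
  assumes "admissible R" "U \<in> Ob B" "V \<in> Ob B" "x \<in> Arr B" "Dom B x = Coprod B U V" "Cod B x = Left R"
    "y \<in> Arr B" "Dom B y = Coprod B U V" "Cod B y = Right R"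
    "Rel R U (x \<cdot> Inj1 B U V) (y \<cdot> Inj1 B U V)" "Rel R V (x \<cdot> Inj2 B U V) (y \<cdot> Inj2 B U V)"
  shows "Rel R (Coprod B U V) x y"
  using assms unfolding admissible_def hom_iff by blast

lemma admissible_Init:
  assumes "admissible R" "x \<in> Arr B" "Dom B x = Init B" "Cod B x = Left R"
    "y \<in> Arr B" "Dom B y = Init B" "Cod B y = Right R"
  shows "Rel R (Init B) x y"
  using assms unfolding admissible_def hom_iff by blast

subsection \<open>Covers are stable under products\<close>

abbreviation undistribute :: "'o \<Rightarrow> 'o \<Rightarrow> 'o \<Rightarrow> 'm" where
  "undistribute D U V \<equiv> copair B (prod_arr B (Id B D) (Inj1 B U V)) (prod_arr B (Id B D) (Inj2 B U V))"

text \<open>Transposing turns equality on \<open>D \<times> (U + V)\<close> into equality of arrows out of \<open>U + V\<close>.\<close>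

lemma prod_Inj_jointly_epi:
  assumes "f \<in> Arr B" "g \<in> Arr B" "Cod B f = Cod B g"
    "Dom B f = Prod B D (Coprod B U V)" "Dom B g = Prod B D (Coprod B U V)"
    "D \<in> Ob B" "U \<in> Ob B" "V \<in> Ob B"
    "f \<cdot> prod_arr B (Id B D) (Inj1 B U V) = g \<cdot> prod_arr B (Id B D) (Inj1 B U V)"
    "f \<cdot> prod_arr B (Id B D) (Inj2 B U V) = g \<cdot> prod_arr B (Id B D) (Inj2 B U V)"
  shows "f = g"
proof -
  let ?c = "\<lambda>f. curry B D (Coprod B U V) f"
  have c: "?c f = ?c g"
  proof (rule copair_eqI[where A = U and C = V])
    show "?c f \<cdot> Inj1 B U V = ?c g \<cdot> Inj1 B U V"
      by (rule exp_eqI[where A = D and C = "Cod B g"]) (use assms in \<open>simp_all add: prod_arr_def\<close>)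
    show "?c f \<cdot> Inj2 B U V = ?c g \<cdot> Inj2 B U V"
      by (rule exp_eqI[where A = D and C = "Cod B g"]) (use assms in \<open>simp_all add: prod_arr_def\<close>)
  qed (use assms in simp_all)
  have "f = Eval B D (Cod B f) \<cdot> prod_arr B (Id B D) (?c f)"
    using assms by (simp add: prod_arr_def)
  also have "\<dots> = Eval B D (Cod B g) \<cdot> prod_arr B (Id B D) (?c g)" using c assms by simp
  also have "\<dots> = g" using assms by (simp add: prod_arr_def)
  finally show ?thesis .
qed

text \<open>A section \<open>t\<close> of \<open>undistribute\<close> is enough: it exhibits any \<open>x\<close> on \<open>D \<times> (U + V)\<close> as a
  restriction along \<open>t\<close> of an arrow on a coproduct.\<close>

lemma distribute:
  assumes "D \<in> Ob B" "U \<in> Ob B" "V \<in> Ob B"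
  obtains t where "t \<in> Arr B" "Dom B t = Prod B D (Coprod B U V)"
    "Cod B t = Coprod B (Prod B D U) (Prod B D V)"
    "undistribute D U V \<cdot> t = Id B (Prod B D (Coprod B U V))"
proof -
  let ?P = "Prod B D U" and ?Q = "Prod B D V"
  \<comment> \<open>The transpose of \<open>t\<close> is defined by cases on \<open>U + V\<close>.\<close>
  let ?c = "copair B (curry B D U (Inj1 B ?P ?Q)) (curry B D V (Inj2 B ?P ?Q))"
  let ?t = "Eval B D (Coprod B ?P ?Q) \<cdot> prod_arr B (Id B D) ?c"
  have t: "?t \<in> Arr B" "Dom B ?t = Prod B D (Coprod B U V)" "Cod B ?t = Coprod B ?P ?Q"
    using assms by simp_all
  have i: "?t \<cdot> prod_arr B (Id B D) (Inj1 B U V) = Inj1 B ?P ?Q"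
    "?t \<cdot> prod_arr B (Id B D) (Inj2 B U V) = Inj2 B ?P ?Q"
    using assms by (simp_all add: prod_arr_def)
  have "undistribute D U V \<cdot> ?t = Id B (Prod B D (Coprod B U V))"
    by (rule prod_Inj_jointly_epi[where D = D and U = U and V = V])
      (use assms t i in simp_all)
  then show ?thesis using that t by blast
qed

lemma admissible_Prod_Coprod:
  assumes R: "admissible R" and ob: "D \<in> Ob B" "U \<in> Ob B" "V \<in> Ob B"
    and x: "x \<in> Arr B" "Dom B x = Prod B D (Coprod B U V)" "Cod B x = Left R"
    and y: "y \<in> Arr B" "Dom B y = Prod B D (Coprod B U V)" "Cod B y = Right R"
    and 1: "Rel R (Prod B D U) (x \<cdot> prod_arr B (Id B D) (Inj1 B U V)) (y \<cdot> prod_arr B (Id B D) (Inj1 B U V))"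
    and 2: "Rel R (Prod B D V) (x \<cdot> prod_arr B (Id B D) (Inj2 B U V)) (y \<cdot> prod_arr B (Id B D) (Inj2 B U V))"
  shows "Rel R (Prod B D (Coprod B U V)) x y"
proof -
  obtain t where t: "t \<in> Arr B" "Dom B t = Prod B D (Coprod B U V)"
    "Cod B t = Coprod B (Prod B D U) (Prod B D V)"
    "undistribute D U V \<cdot> t = Id B (Prod B D (Coprod B U V))"
    using distribute[OF ob] .
  let ?s = "undistribute D U V"
  have "Rel R (Coprod B (Prod B D U) (Prod B D V)) (x \<cdot> ?s) (y \<cdot> ?s)"
    by (rule admissible_Coprod) (use assms in simp_all)
  from admissible_restrict[OF R this t(1,3) refl] show ?thesis
    using ob x y t by simp
qed

text \<open>\<open>D \<times> O\<close> is initial, because arrows out of it transpose to arrows out of \<open>O\<close>; so every arrow on it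
  is a restriction of one on \<open>O\<close>.\<close>

lemma admissible_Prod_Init:
  assumes R: "admissible R" and ob: "D \<in> Ob B"
    and x: "x \<in> Arr B" "Dom B x = Prod B D (Init B)" "Cod B x = Left R"
    and y: "y \<in> Arr B" "Dom B y = Prod B D (Init B)" "Cod B y = Right R"
  shows "Rel R (Prod B D (Init B)) x y"
proof -
  let ?P = "Prod B D (Init B)" and ?p = "Proj2 B D (Init B)"
  let ?i = "sp_l B (Prod B D (Init B))"
  let ?c = "\<lambda>f. curry B D (Init B) f"
  have c: "?c (?i \<cdot> ?p) = ?c (Id B ?P)" by (rule init_eqI) (use ob in simp_all)
  have "?i \<cdot> ?p = Eval B D ?P \<cdot> prod_arr B (Id B D) (?c (?i \<cdot> ?p))"
    using ob by (simp add: prod_arr_def)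
  also have "\<dots> = Id B ?P" using ob unfolding c by (simp add: prod_arr_def)
  finally have i: "?i \<cdot> ?p = Id B ?P" .
  have "Rel R (Init B) (x \<cdot> ?i) (y \<cdot> ?i)" by (rule admissible_Init) (use assms in simp_all)
  from admissible_restrict[OF R this, of ?p ?P] show ?thesis
    using ob x y i by simp
qed

subsection \<open>The type constructors on relations\<close>

definition prodR where
  "prodR R S = \<lparr>Left = Prod B (Left R) (Left S), Right = Prod B (Right R) (Right S),
     Rel = (\<lambda>D x y. x \<in> hom B D (Prod B (Left R) (Left S)) \<and> y \<in> hom B D (Prod B (Right R) (Right S)) \<and>
       Rel R D (Proj1 B (Left R) (Left S) \<cdot> x) (Proj1 B (Right R) (Right S) \<cdot> y) \<and>
       Rel S D (Proj2 B (Left R) (Left S) \<cdot> x) (Proj2 B (Right R) (Right S) \<cdot> y))\<rparr>"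

text \<open>Related functions send related arguments, defined at any stage \<open>D'\<close>, to related values.  Passing to
  \<open>D' \<times> D\<close> instead of stages over \<open>D\<close> amounts to the usual Kripke condition by stability under
  precomposition.\<close>

definition expR where
  "expR R S = \<lparr>Left = Exp B (Left R) (Left S), Right = Exp B (Right R) (Right S),
     Rel = (\<lambda>D x y. x \<in> hom B D (Exp B (Left R) (Left S)) \<and> y \<in> hom B D (Exp B (Right R) (Right S)) \<and>
       (\<forall>D' a b. Rel R D' a b \<longrightarrow>
         Rel S (Prod B D' D) (Eval B (Left R) (Left S) \<cdot> prod_arr B a x)
                             (Eval B (Right R) (Right S) \<cdot> prod_arr B b y)))\<rparr>"

text \<open>An element of a coproduct at a stage need not factor through an injection, not even after
  restriction to a cover of that stage.  The relation is the least one that contains the images of the injections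
  and is stable under restriction and gluing; alternating the two yields, for instance,
  pairs pulled back along an arrow into some \<open>U + V\<close>.\<close>

inductive sumRel :: "('o, 'm) lrel \<Rightarrow> ('o, 'm) lrel \<Rightarrow> 'o \<Rightarrow> 'm \<Rightarrow> 'm \<Rightarrow> bool" for R S where
  inj1: "Rel R D x y \<Longrightarrow>
    sumRel R S D (Inj1 B (Left R) (Left S) \<cdot> x) (Inj1 B (Right R) (Right S) \<cdot> y)"
| inj2: "Rel S D x y \<Longrightarrow>
    sumRel R S D (Inj2 B (Left R) (Left S) \<cdot> x) (Inj2 B (Right R) (Right S) \<cdot> y)"
| restrict: "sumRel R S D x y \<Longrightarrow> e \<in> Arr B \<Longrightarrow> Cod B e = D \<Longrightarrow> sumRel R S (Dom B e) (x \<cdot> e) (y \<cdot> e)"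
| glue: "U \<in> Ob B \<Longrightarrow> V \<in> Ob B \<Longrightarrow>
    x \<in> hom B (Coprod B U V) (Coprod B (Left R) (Left S)) \<Longrightarrow>
    y \<in> hom B (Coprod B U V) (Coprod B (Right R) (Right S)) \<Longrightarrow>
    sumRel R S U (x \<cdot> Inj1 B U V) (y \<cdot> Inj1 B U V) \<Longrightarrow>
    sumRel R S V (x \<cdot> Inj2 B U V) (y \<cdot> Inj2 B U V) \<Longrightarrow> sumRel R S (Coprod B U V) x y"
| glue_empty: "x \<in> hom B (Init B) (Coprod B (Left R) (Left S)) \<Longrightarrow>
    y \<in> hom B (Init B) (Coprod B (Right R) (Right S)) \<Longrightarrow> sumRel R S (Init B) x y"

definition sumR where
  "sumR R S = \<lparr>Left = Coprod B (Left R) (Left S), Right = Coprod B (Right R) (Right S),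
     Rel = sumRel R S\<rparr>"

definition termR where
  "termR = \<lparr>Left = Term B, Right = Term B,
     Rel = (\<lambda>D x y. x \<in> hom B D (Term B) \<and> y \<in> hom B D (Term B))\<rparr>"

definition graphR where
  "graphR f = \<lparr>Left = Dom B f, Right = Cod B f,
     Rel = (\<lambda>D x y. x \<in> hom B D (Dom B f) \<and> y = f \<cdot> x)\<rparr>"

lemma lrel_sides [simp]:
  "Left (prodR R S) = Prod B (Left R) (Left S)" "Right (prodR R S) = Prod B (Right R) (Right S)"
  "Left (expR R S) = Exp B (Left R) (Left S)" "Right (expR R S) = Exp B (Right R) (Right S)"
  "Left (sumR R S) = Coprod B (Left R) (Left S)" "Right (sumR R S) = Coprod B (Right R) (Right S)"
  "Left termR = Term B" "Right termR = Term B"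
  "Left (graphR f) = Dom B f" "Right (graphR f) = Cod B f"
  by (simp_all add: prodR_def expR_def sumR_def termR_def graphR_def)

lemma admissible_prodR:
  assumes R: "admissible R" and S: "admissible S"
  shows "admissible (prodR R S)"
proof (rule admissibleI)
  fix D x y e
  assume "Rel (prodR R S) D x y" and e: "e \<in> Arr B" "Cod B e = D"
  then have x: "x \<in> Arr B" "Dom B x = D" "Cod B x = Prod B (Left R) (Left S)"
    and y: "y \<in> Arr B" "Dom B y = D" "Cod B y = Prod B (Right R) (Right S)"
    and 1: "Rel R D (Proj1 B (Left R) (Left S) \<cdot> x) (Proj1 B (Right R) (Right S) \<cdot> y)"
    and 2: "Rel S D (Proj2 B (Left R) (Left S) \<cdot> x) (Proj2 B (Right R) (Right S) \<cdot> y)"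
    by (simp_all add: prodR_def hom_iff)
  show "Rel (prodR R S) (Dom B e) (x \<cdot> e) (y \<cdot> e)"
    using admissible_restrict[OF R 1 e refl] admissible_restrict[OF S 2 e refl] x y e R S
    by (simp add: prodR_def hom_iff)
next
  fix U V x y
  assume "U \<in> Ob B" "V \<in> Ob B"
    "x \<in> hom B (Coprod B U V) (Left (prodR R S))" "y \<in> hom B (Coprod B U V) (Right (prodR R S))"
    "Rel (prodR R S) U (x \<cdot> Inj1 B U V) (y \<cdot> Inj1 B U V)"
    "Rel (prodR R S) V (x \<cdot> Inj2 B U V) (y \<cdot> Inj2 B U V)"
  then show "Rel (prodR R S) (Coprod B U V) x y"
    using R S by (auto simp: prodR_def hom_iff intro!: admissible_Coprod)
qed (use R S in \<open>auto simp: prodR_def hom_iff intro!: admissible_Init\<close>)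

lemma admissible_termR: "admissible termR"
  by (rule admissibleI) (auto simp: termR_def hom_iff)

text \<open>Locality holds because arrows out of a coproduct or the initial object are determined by
  their restrictions.\<close>

lemma admissible_graphR:
  assumes f: "f \<in> Arr B"
  shows "admissible (graphR f)"
proof (rule admissibleI)
  fix U V x y
  assume ob: "U \<in> Ob B" "V \<in> Ob B"
    and x: "x \<in> hom B (Coprod B U V) (Left (graphR f))"
    and y: "y \<in> hom B (Coprod B U V) (Right (graphR f))"
    and 1: "Rel (graphR f) U (x \<cdot> Inj1 B U V) (y \<cdot> Inj1 B U V)"
    and 2: "Rel (graphR f) V (x \<cdot> Inj2 B U V) (y \<cdot> Inj2 B U V)"
  have "y = f \<cdot> x"
    by (rule copair_eqI[where A = U and C = V])
      (use f ob x y 1 2 in \<open>simp_all add: graphR_def hom_iff\<close>)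
  then show "Rel (graphR f) (Coprod B U V) x y"
    using x by (simp add: graphR_def)
next
  fix x y
  assume "x \<in> hom B (Init B) (Left (graphR f))" "y \<in> hom B (Init B) (Right (graphR f))"
  then show "Rel (graphR f) (Init B) x y"
    using f by (auto simp: graphR_def hom_iff intro!: init_eqI)
qed (use f in \<open>auto simp: graphR_def hom_iff\<close>)

lemma sumRel_hom:
  assumes "admissible R" "admissible S"
  shows "sumRel R S D x y \<Longrightarrow>
    x \<in> hom B D (Coprod B (Left R) (Left S)) \<and> y \<in> hom B D (Coprod B (Right R) (Right S))"
proof (induction rule: sumRel.induct)
  case (inj1 D x y)
  then show ?case using admissible_hom[OF assms(1)] assms by (auto simp: hom_iff)
next
  case (inj2 D x y)
  then show ?case using admissible_hom[OF assms(2)] assms by (auto simp: hom_iff)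
qed (auto simp: hom_iff)

lemma admissible_sumR:
  assumes R: "admissible R" and S: "admissible S"
  shows "admissible (sumR R S)"
  by (rule admissibleI)
    (use assms sumRel_hom in \<open>auto simp: sumR_def intro: sumRel.restrict sumRel.glue sumRel.glue_empty\<close>)

text \<open>For \<open>x\<close>, \<open>y\<close> at a coproduct \<open>U + V\<close> and arguments at stage \<open>D'\<close>, the values live at \<open>D' \<times> (U + V)\<close>, so
  stability of covers under products is needed.\<close>

lemma admissible_expR:
  assumes R: "admissible R" and S: "admissible S"
  shows "admissible (expR R S)"
proof (rule admissibleI)
  fix D x y e
  assume "Rel (expR R S) D x y" and e: "e \<in> Arr B" "Cod B e = D"
  then have x: "x \<in> Arr B" "Dom B x = D" "Cod B x = Exp B (Left R) (Left S)"
    and y: "y \<in> Arr B" "Dom B y = D" "Cod B y = Exp B (Right R) (Right S)"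
    and r: "\<And>D' a b. Rel R D' a b \<Longrightarrow>
         Rel S (Prod B D' D) (Eval B (Left R) (Left S) \<cdot> prod_arr B a x)
                             (Eval B (Right R) (Right S) \<cdot> prod_arr B b y)"
    by (simp_all add: expR_def hom_iff)
  have "Rel S (Prod B D' (Dom B e)) (Eval B (Left R) (Left S) \<cdot> prod_arr B a (x \<cdot> e))
          (Eval B (Right R) (Right S) \<cdot> prod_arr B b (y \<cdot> e))" if ab: "Rel R D' a b" for D' a b
  proof -
    note h = admissible_hom[OF R ab]
    have D: "D \<in> Ob B" using e by auto
    have "Rel S (Prod B D' (Dom B e)) ((Eval B (Left R) (Left S) \<cdot> prod_arr B a x) \<cdot> prod_arr B (Id B D') e)
          ((Eval B (Right R) (Right S) \<cdot> prod_arr B b y) \<cdot> prod_arr B (Id B D') e)"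
      by (rule admissible_restrict[OF S r[OF ab]]) (use h x y e in simp_all)
    moreover have "(Eval B (Left R) (Left S) \<cdot> prod_arr B a x) \<cdot> prod_arr B (Id B D') e =
        Eval B (Left R) (Left S) \<cdot> prod_arr B a (x \<cdot> e)"
      using h D x y e R S by (simp add: prod_arr_def)
    moreover have "(Eval B (Right R) (Right S) \<cdot> prod_arr B b y) \<cdot> prod_arr B (Id B D') e =
        Eval B (Right R) (Right S) \<cdot> prod_arr B b (y \<cdot> e)"
      using h D x y e R S by (simp add: prod_arr_def)
    ultimately show ?thesis by simp
  qed
  then show "Rel (expR R S) (Dom B e) (x \<cdot> e) (y \<cdot> e)"
    using x y e by (simp add: expR_def hom_iff)
next
  fix U V x y
  assume ob: "U \<in> Ob B" "V \<in> Ob B" and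
    "x \<in> hom B (Coprod B U V) (Left (expR R S))" "y \<in> hom B (Coprod B U V) (Right (expR R S))"
    and r: "Rel (expR R S) U (x \<cdot> Inj1 B U V) (y \<cdot> Inj1 B U V)"
    "Rel (expR R S) V (x \<cdot> Inj2 B U V) (y \<cdot> Inj2 B U V)"
  then have x: "x \<in> Arr B" "Dom B x = Coprod B U V" "Cod B x = Exp B (Left R) (Left S)"
    and y: "y \<in> Arr B" "Dom B y = Coprod B U V" "Cod B y = Exp B (Right R) (Right S)"
    by (simp_all add: hom_iff)
  have "Rel S (Prod B D' (Coprod B U V)) (Eval B (Left R) (Left S) \<cdot> prod_arr B a x)
          (Eval B (Right R) (Right S) \<cdot> prod_arr B b y)" if ab: "Rel R D' a b" for D' a b
  proof -
    note h = admissible_hom[OF R ab]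
    have "Rel S (Prod B D' U) (Eval B (Left R) (Left S) \<cdot> prod_arr B a (x \<cdot> Inj1 B U V))
          (Eval B (Right R) (Right S) \<cdot> prod_arr B b (y \<cdot> Inj1 B U V))"
      "Rel S (Prod B D' V) (Eval B (Left R) (Left S) \<cdot> prod_arr B a (x \<cdot> Inj2 B U V))
          (Eval B (Right R) (Right S) \<cdot> prod_arr B b (y \<cdot> Inj2 B U V))"
      using r ab by (simp_all add: expR_def)
    then show ?thesis
      by (intro admissible_Prod_Coprod) (use h ob x y R S in \<open>simp_all add: prod_arr_def\<close>)
  qed
  then show "Rel (expR R S) (Coprod B U V) x y"
    using x y by (simp add: expR_def hom_iff)
next
  fix x y
  assume "x \<in> hom B (Init B) (Left (expR R S))" "y \<in> hom B (Init B) (Right (expR R S))"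
  then have x: "x \<in> Arr B" "Dom B x = Init B" "Cod B x = Exp B (Left R) (Left S)"
    and y: "y \<in> Arr B" "Dom B y = Init B" "Cod B y = Exp B (Right R) (Right S)"
    by (simp_all add: hom_iff)
  have "Rel S (Prod B D' (Init B)) (Eval B (Left R) (Left S) \<cdot> prod_arr B a x)
          (Eval B (Right R) (Right S) \<cdot> prod_arr B b y)" if ab: "Rel R D' a b" for D' a b
    by (rule admissible_Prod_Init) (use admissible_hom[OF R ab] x y R S in simp_all)
  then show "Rel (expR R S) (Init B) x y"
    using x y by (simp add: expR_def hom_iff)
qed (use R S in \<open>auto simp: expR_def\<close>)

subsection \<open>Morphisms of relations\<close>

definition morph where
  "morph R S f g \<longleftrightarrow> admissible R \<and> admissible S \<and> f \<in> hom B (Left R) (Left S) \<and> g \<in> hom B (Right R) (Right S) \<and>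
     (\<forall>D x y. Rel R D x y \<longrightarrow> Rel S D (f \<cdot> x) (g \<cdot> y))"

lemma morphI:
  assumes "admissible R" "admissible S" "f \<in> Arr B" "Dom B f = Left R" "Cod B f = Left S"
    "g \<in> Arr B" "Dom B g = Right R" "Cod B g = Right S"
    "\<And>D x y. Rel R D x y \<Longrightarrow> Rel S D (f \<cdot> x) (g \<cdot> y)"
  shows "morph R S f g"
  using assms by (simp add: morph_def hom_iff)

lemma morph_simps:
  assumes "morph R S f g"
  shows "f \<in> Arr B" "Dom B f = Left R" "Cod B f = Left S"
    "g \<in> Arr B" "Dom B g = Right R" "Cod B g = Right S" "admissible R" "admissible S"
  using assms by (simp_all add: morph_def hom_iff)

lemma morph_rel: "morph R S f g \<Longrightarrow> Rel R D x y \<Longrightarrow> Rel S D (f \<cdot> x) (g \<cdot> y)"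
  by (simp add: morph_def)

lemma morph_Id: "admissible R \<Longrightarrow> morph R R (Id B (Left R)) (Id B (Right R))"
  by (rule morphI) (simp_all add: admissible_hom[of R])

lemma morph_Comp:
  assumes f: "morph R S f g" and f': "morph S T f' g'"
  shows "morph R T (f' \<cdot> f) (g' \<cdot> g)"
proof (rule morphI)
  fix D x y assume x: "Rel R D x y"
  have "Rel T D (f' \<cdot> f \<cdot> x) (g' \<cdot> g \<cdot> y)" by (rule morph_rel[OF f' morph_rel[OF f x]])
  then show "Rel T D ((f' \<cdot> f) \<cdot> x) ((g' \<cdot> g) \<cdot> y)"
    using admissible_hom[OF morph_simps(7)[OF f] x] morph_simps[OF f] morph_simps[OF f'] by simp
qed (use morph_simps[OF f] morph_simps[OF f'] in simp_all)

lemma morph_Proj1: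
  assumes "admissible R" "admissible S"
  shows "morph (prodR R S) R (Proj1 B (Left R) (Left S)) (Proj1 B (Right R) (Right S))"
  by (rule morphI) (use assms admissible_prodR in \<open>auto simp: prodR_def\<close>)

lemma morph_Proj2:
  assumes "admissible R" "admissible S"
  shows "morph (prodR R S) S (Proj2 B (Left R) (Left S)) (Proj2 B (Right R) (Right S))"
  by (rule morphI) (use assms admissible_prodR in \<open>auto simp: prodR_def\<close>)

lemma morph_pair:
  assumes f: "morph R S f g" and f': "morph R T f' g'"
  shows "morph R (prodR S T) (pair B f f') (pair B g g')"
proof (rule morphI)
  fix D x y assume x: "Rel R D x y"
  show "Rel (prodR S T) D (pair B f f' \<cdot> x) (pair B g g' \<cdot> y)"
    using morph_rel[OF f x] morph_rel[OF f' x]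
      admissible_hom[OF morph_simps(7)[OF f] x] morph_simps[OF f] morph_simps[OF f']
    by (simp add: prodR_def hom_iff)
qed (use morph_simps[OF f] morph_simps[OF f'] admissible_prodR in simp_all)

lemma morph_k:
  assumes "admissible R"
  shows "morph R termR (sp_k B (Left R)) (sp_k B (Right R))"
  by (rule morphI)
    (use assms admissible_termR admissible_hom[OF assms] in \<open>auto simp: termR_def hom_iff\<close>)

lemma morph_Inj1:
  assumes "admissible R" "admissible S"
  shows "morph R (sumR R S) (Inj1 B (Left R) (Left S)) (Inj1 B (Right R) (Right S))"
  by (rule morphI) (use assms admissible_sumR in \<open>auto simp: sumR_def intro: sumRel.intros\<close>)

lemma morph_Inj2:
  assumes "admissible R" "admissible S"
  shows "morph S (sumR R S) (Inj2 B (Left R) (Left S)) (Inj2 B (Right R) (Right S))"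
  by (rule morphI) (use assms admissible_sumR in \<open>auto simp: sumR_def intro: sumRel.intros\<close>)

text \<open>Induction on the generation of the relation on the coproduct: the target relation
  is itself closed under the rules for restriction and gluing.\<close>

lemma morph_copair:
  assumes f: "morph R T f g" and f': "morph S T f' g'"
  shows "morph (sumR R S) T (copair B f f') (copair B g g')"
proof (rule morphI)
  note ms = morph_simps[OF f] morph_simps[OF f']
  have R: "admissible R" and S: "admissible S" and T: "admissible T" using ms by simp_all
  fix D x y assume "Rel (sumR R S) D x y"
  then have "sumRel R S D x y" by (simp add: sumR_def)
  then show "Rel T D (copair B f f' \<cdot> x) (copair B g g' \<cdot> y)"
  proof (induction rule: sumRel.induct)
    case (inj1 D x y)
    then show ?case using morph_rel[OF f inj1] admissible_hom[OF R inj1] ms by simp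
  next
    case (inj2 D x y)
    then show ?case using morph_rel[OF f' inj2] admissible_hom[OF S inj2] ms by simp
  next
    case (restrict D x y e)
    then show ?case
      using admissible_restrict[OF T restrict.IH restrict.hyps(2,3) refl]
        sumRel_hom[OF R S restrict.hyps(1)] ms by (simp add: hom_iff)
  next
    case (glue U V x y)
    then show ?case by (intro admissible_Coprod[OF T]) (use ms in \<open>simp_all add: hom_iff\<close>)
  next
    case (glue_empty x y)
    then show ?case by (intro admissible_Init[OF T]) (use ms in \<open>simp_all add: hom_iff\<close>)
  qed
qed (use morph_simps[OF f] morph_simps[OF f'] admissible_sumR in simp_all)

text \<open>The relation on the initial object is equality (the graph of its identity): this is already local,
  and every stage \<open>D\<close> with an arrow to \<open>O\<close> inherits what holds over \<open>O\<close>.\<close>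

lemma morph_l:
  assumes R: "admissible R"
  shows "morph (graphR (Id B (Init B))) R (sp_l B (Left R)) (sp_l B (Right R))"
proof (rule morphI)
  fix D x y assume "Rel (graphR (Id B (Init B))) D x y"
  then have x: "x \<in> Arr B" "D = Dom B x" "Cod B x = Init B" "y = x"
    by (auto simp: graphR_def hom_iff)
  have "Rel R (Init B) (sp_l B (Left R)) (sp_l B (Right R))"
    by (rule admissible_Init) (use R in simp_all)
  from admissible_restrict[OF R this x(1,3,2)] show "Rel R D (sp_l B (Left R) \<cdot> x) (sp_l B (Right R) \<cdot> y)"
    using x by simp
qed (use R admissible_graphR in simp_all)

text \<open>The definition of \<open>expR\<close> relates values at stage \<open>D \<times> D\<close>; restrict along the diagonal.\<close>

lemma morph_Eval:
  assumes R: "admissible R" and S: "admissible S"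
  shows "morph (prodR R (expR R S)) S (Eval B (Left R) (Left S)) (Eval B (Right R) (Right S))"
proof (rule morphI)
  fix D x y assume xy: "Rel (prodR R (expR R S)) D x y"
  let ?E = "Exp B (Left R) (Left S)" and ?E' = "Exp B (Right R) (Right S)"
  note h = admissible_hom[OF admissible_prodR[OF R admissible_expR[OF R S]] xy]
  have "Rel R D (Proj1 B (Left R) ?E \<cdot> x) (Proj1 B (Right R) ?E' \<cdot> y)"
    and "Rel (expR R S) D (Proj2 B (Left R) ?E \<cdot> x) (Proj2 B (Right R) ?E' \<cdot> y)"
    using xy by (simp_all add: prodR_def)
  then have "Rel S (Prod B D D)
      (Eval B (Left R) (Left S) \<cdot> prod_arr B (Proj1 B (Left R) ?E \<cdot> x) (Proj2 B (Left R) ?E \<cdot> x))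
      (Eval B (Right R) (Right S) \<cdot> prod_arr B (Proj1 B (Right R) ?E' \<cdot> y) (Proj2 B (Right R) ?E' \<cdot> y))"
    unfolding expR_def by simp
  from admissible_restrict[OF S this, of "pair B (Id B D) (Id B D)" D]
  show "Rel S D (Eval B (Left R) (Left S) \<cdot> x) (Eval B (Right R) (Right S) \<cdot> y)"
    using h R S by (simp add: prod_arr_def)
qed (use R S admissible_prodR admissible_expR in simp_all)

lemma morph_curry:
  assumes R: "admissible R" and T: "admissible T" and f: "morph (prodR R T) S f g"
  shows "morph T (expR R S) (curry B (Left R) (Left T) f) (curry B (Right R) (Right T) g)"
proof (rule morphI)
  note ms = morph_simps[OF f]
  fix D x y assume xy: "Rel T D x y"
  note h = admissible_hom[OF T xy]
  have "Rel S (Prod B D' D)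
      (Eval B (Left R) (Left S) \<cdot> prod_arr B a (curry B (Left R) (Left T) f \<cdot> x))
      (Eval B (Right R) (Right S) \<cdot> prod_arr B b (curry B (Right R) (Right T) g \<cdot> y))"
    if ab: "Rel R D' a b" for D' a b
  proof -
    note k = admissible_hom[OF R ab]
    have "Rel (prodR R T) (Prod B D' D) (prod_arr B a x) (prod_arr B b y)"
      using admissible_restrict[OF R ab, of "Proj1 B D' D"] admissible_restrict[OF T xy, of "Proj2 B D' D"] h k
      by (simp add: prodR_def hom_iff prod_arr_def)
    from morph_rel[OF f this] show ?thesis
      using ms h k R T by (simp add: prod_arr_def)
  qed
  then show "Rel (expR R S) D (curry B (Left R) (Left T) f \<cdot> x) (curry B (Right R) (Right T) g \<cdot> y)"
    using ms h R T by (simp add: expR_def hom_iff)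
qed (use morph_simps[OF f] R T admissible_expR in simp_all)

lemma morph_prod_arr:
  assumes f: "morph R S f g" and f': "morph R' S' f' g'"
  shows "morph (prodR R R') (prodR S S') (prod_arr B f f') (prod_arr B g g')"
  unfolding prod_arr_def morph_simps[OF f] morph_simps[OF f']
  by (intro morph_pair morph_Comp[OF morph_Proj1 f] morph_Comp[OF morph_Proj2 f'])
    (use morph_simps[OF f] morph_simps[OF f'] in simp_all)

lemma morph_coprod_arr:
  assumes f: "morph R S f g" and f': "morph R' S' f' g'"
  shows "morph (sumR R R') (sumR S S') (coprod_arr B f f') (coprod_arr B g g')"
  unfolding coprod_arr_def morph_simps[OF f] morph_simps[OF f']
  by (intro morph_copair morph_Comp[OF f morph_Inj1] morph_Comp[OF f' morph_Inj2])
    (use morph_simps[OF f] morph_simps[OF f'] in simp_all)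

lemma morph_exp_arr:
  assumes f: "morph R S f g" and f': "morph R' S' f' g'"
  shows "morph (expR S R') (expR R S') (exp_arr B f f') (exp_arr B g g')"
proof -
  note ms = morph_simps[OF f] morph_simps[OF f']
  have E: "admissible (expR S R')" using ms by (simp add: admissible_expR)
  have "morph (prodR R (expR S R')) S'
      (f' \<cdot> Eval B (Left S) (Left R') \<cdot> prod_arr B f (Id B (Left (expR S R'))))
      (g' \<cdot> Eval B (Right S) (Right R') \<cdot> prod_arr B g (Id B (Right (expR S R'))))"
    by (rule morph_Comp[OF morph_Comp[OF morph_prod_arr[OF f morph_Id[OF E]]] f'], rule morph_Eval)
      (use ms in simp_all)
  from morph_curry[OF _ E this] show ?thesis
    using ms by (simp add: exp_arr_def Let_def)
qed

section \<open>The objects of \<open>\<F>\<^sub>\<B>\<close> are functors\<close>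


lemma obs_append [simp]:
  "As @ Cs \<in> obs B n \<longleftrightarrow> (\<exists>m k. n = m + k \<and> As \<in> obs B m \<and> Cs \<in> obs B k)"
  by (auto simp: obs_def)

lemma obs_splitE:
  assumes "As \<in> obs B (m + n)"
  obtains As1 As2 where "As = As1 @ As2" "As1 \<in> obs B m" "As2 \<in> obs B n"
proof (rule that)
  show "As = take m As @ drop m As" by simp
  show "take m As \<in> obs B m" "drop m As \<in> obs B n"
    using assms by (auto simp: obs_def dest: in_set_takeD in_set_dropD)
qed

lemma arrs_splitE:
  assumes "fs \<in> arrs B (m + n)"
  obtains fs1 fs2 where "fs = fs1 @ fs2" "fs1 \<in> arrs B m" "fs2 \<in> arrs B n"
proof (rule that)
  show "fs = take m fs @ drop m fs" by simp
  show "take m fs \<in> arrs B m" "drop m fs \<in> arrs B n"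
    using assms by (auto simp: arrs_def dest: in_set_takeD in_set_dropD)
qed

lemma lengths [simp]:
  "As \<in> obs B n \<Longrightarrow> length As = n" "fs \<in> arrs B n \<Longrightarrow> length fs = n"
  by (auto simp: obs_def arrs_def)

lemma is_functor_omap: "is_functor B T \<Longrightarrow> As \<in> obs B (length (signs T)) \<Longrightarrow> omap T As \<in> Ob B"
  by (simp add: is_functor_def Let_def)

lemma is_functor_amap:
  assumes "is_functor B T" "fs \<in> arrs B (length (signs T))"
  shows "amap T fs \<in> Arr B" "Dom B (amap T fs) = omap T (map2 (sdom B) (signs T) fs)"
    "Cod B (amap T fs) = omap T (map2 (scod B) (signs T) fs)"
  using assms by (auto simp: is_functor_def Let_def hom_iff)

lemma is_functor_Id:
  "is_functor B T \<Longrightarrow> As \<in> obs B (length (signs T)) \<Longrightarrow> amap T (map (Id B) As) = Id B (omap T As)"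
  by (simp add: is_functor_def Let_def)

abbreviation scomps :: "bool list \<Rightarrow> 'm list \<Rightarrow> 'm list \<Rightarrow> 'm list" where
  "scomps ss gs fs \<equiv> map (\<lambda>j. scomp B (ss ! j) (gs ! j) (fs ! j)) [0..<length ss]"

lemma is_functor_Comp:
  "is_functor B T \<Longrightarrow> fs \<in> arrs B (length (signs T)) \<Longrightarrow> gs \<in> arrs B (length (signs T)) \<Longrightarrow>
    map2 (scod B) (signs T) fs = map2 (sdom B) (signs T) gs \<Longrightarrow>
    amap T (scomps (signs T) gs fs) = Comp B (amap T gs) (amap T fs)"
  by (simp add: is_functor_def Let_def)

lemma is_functorI:
  assumes "\<And>As. As \<in> obs B (length (signs T)) \<Longrightarrow> omap T As \<in> Ob B"
    and "\<And>fs. fs \<in> arrs B (length (signs T)) \<Longrightarrow> amap T fs \<in> hom B (omap T (map2 (sdom B) (signs T) fs))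
                                      (omap T (map2 (scod B) (signs T) fs))"
    and "\<And>As. As \<in> obs B (length (signs T)) \<Longrightarrow> amap T (map (Id B) As) = Id B (omap T As)"
    and "\<And>fs gs. fs \<in> arrs B (length (signs T)) \<Longrightarrow> gs \<in> arrs B (length (signs T)) \<Longrightarrow>
        map2 (scod B) (signs T) fs = map2 (sdom B) (signs T) gs \<Longrightarrow>
        amap T (scomps (signs T) gs fs) = Comp B (amap T gs) (amap T fs)"
  shows "is_functor B T"
  using assms by (simp add: is_functor_def Let_def)

lemma scomps_append:
  assumes "length gs = length ss" "length fs = length ss"
  shows "scomps (ss @ ss') (gs @ gs') (fs @ fs') = scomps ss gs fs @ scomps ss' gs' fs'"
  by (rule nth_equalityI) (use assms in \<open>auto simp: nth_append\<close>)

lemma sdom_Not: "length fs = length ss \<Longrightarrow> map2 (sdom B) (map Not ss) fs = map2 (scod B) ss fs"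
  "length fs = length ss \<Longrightarrow> map2 (scod B) (map Not ss) fs = map2 (sdom B) ss fs"
  "length fs = length ss \<Longrightarrow> length gs = length ss \<Longrightarrow>
    scomps (map Not ss @ ss') (gs @ gs') (fs @ fs') = scomps ss fs gs @ scomps ss' gs' fs'"
  by (auto intro!: nth_equalityI simp: nth_append sdom_def scod_def scomp_def)

lemma is_functor_combine:
  assumes T: "is_functor B T" and S: "is_functor B S"
    and ob: "\<And>A C. A \<in> Ob B \<Longrightarrow> C \<in> Ob B \<Longrightarrow> sto A C \<in> Ob B"
    and ar: "\<And>f g. f \<in> Arr B \<Longrightarrow> g \<in> Arr B \<Longrightarrow>
      sta f g \<in> hom B (sto (Dom B f) (Dom B g)) (sto (Cod B f) (Cod B g))"
    and Id: "\<And>A C. A \<in> Ob B \<Longrightarrow> C \<in> Ob B \<Longrightarrow> sta (Id B A) (Id B C) = Id B (sto A C)"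
    and Comp: "\<And>f g f' g'. f \<in> Arr B \<Longrightarrow> g \<in> Arr B \<Longrightarrow> Cod B f = Dom B g \<Longrightarrow>
      f' \<in> Arr B \<Longrightarrow> g' \<in> Arr B \<Longrightarrow> Cod B f' = Dom B g' \<Longrightarrow>
      sta (g \<cdot> f) (g' \<cdot> f') = sta g g' \<cdot> sta f f'"
  shows "is_functor B (combine (signs T) sto sta T S)"
proof (rule is_functorI)
  fix As assume "As \<in> obs B (length (signs (combine (signs T) sto sta T S)))"
  then show "omap (combine (signs T) sto sta T S) As \<in> Ob B"
    "amap (combine (signs T) sto sta T S) (map (Id B) As) = Id B (omap (combine (signs T) sto sta T S) As)"
    by (auto simp: combine_def Let_def ob Id is_functor_Id[OF T] is_functor_Id[OF S]
        is_functor_omap[OF T] is_functor_omap[OF S] elim!: obs_splitE)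
next
  fix fs assume "fs \<in> arrs B (length (signs (combine (signs T) sto sta T S)))"
  then obtain f1 f2 where fs: "fs = f1 @ f2" and
    f: "f1 \<in> arrs B (length (signs T))" "f2 \<in> arrs B (length (signs S))"
    by (auto simp: combine_def Let_def elim!: arrs_splitE)
  note a = is_functor_amap[OF T f(1)] is_functor_amap[OF S f(2)]
  show "amap (combine (signs T) sto sta T S) fs \<in> hom B
     (omap (combine (signs T) sto sta T S) (map2 (sdom B) (signs (combine (signs T) sto sta T S)) fs))
     (omap (combine (signs T) sto sta T S) (map2 (scod B) (signs (combine (signs T) sto sta T S)) fs))"
    using ar[OF a(1) a(4)] a f by (simp add: combine_def Let_def fs)
  fix gs assume "gs \<in> arrs B (length (signs (combine (signs T) sto sta T S)))"
  then obtain g1 g2 where gs: "gs = g1 @ g2" and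
    g: "g1 \<in> arrs B (length (signs T))" "g2 \<in> arrs B (length (signs S))"
    by (auto simp: combine_def Let_def elim!: arrs_splitE)
  note b = is_functor_amap[OF T g(1)] is_functor_amap[OF S g(2)]
  assume "map2 (scod B) (signs (combine (signs T) sto sta T S)) fs =
    map2 (sdom B) (signs (combine (signs T) sto sta T S)) gs"
  then have e: "map2 (scod B) (signs T) f1 = map2 (sdom B) (signs T) g1"
    "map2 (scod B) (signs S) f2 = map2 (sdom B) (signs S) g2"
    using f g by (simp_all add: combine_def Let_def fs gs)
  show "amap (combine (signs T) sto sta T S) (scomps (signs (combine (signs T) sto sta T S)) gs fs) =
     amap (combine (signs T) sto sta T S) gs \<cdot> amap (combine (signs T) sto sta T S) fs"
    using f g scomps_append[of g1 "signs T" f1 "signs S" g2 f2]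
      is_functor_Comp[OF T f(1) g(1) e(1)] is_functor_Comp[OF S f(2) g(2) e(2)] a b e Comp
    by (simp add: combine_def Let_def fs gs del: map_append upt_add_eq_append)
qed

lemma is_functor_combine_exp:
  assumes T: "is_functor B T" and S: "is_functor B S"
  shows "is_functor B (combine (map Not (signs T)) (Exp B) (exp_arr B) T S)"
    (is "is_functor B ?E")
proof (rule is_functorI)
  fix As assume "As \<in> obs B (length (signs ?E))"
  then show "omap ?E As \<in> Ob B" "amap ?E (map (Id B) As) = Id B (omap ?E As)"
    by (auto simp: combine_def Let_def exp_arr_Id is_functor_Id[OF T] is_functor_Id[OF S]
        is_functor_omap[OF T] is_functor_omap[OF S] elim!: obs_splitE)
next
  fix fs assume "fs \<in> arrs B (length (signs ?E))"
  then obtain f1 f2 where fs: "fs = f1 @ f2" and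
    f: "f1 \<in> arrs B (length (signs T))" "f2 \<in> arrs B (length (signs S))"
    by (auto simp: combine_def Let_def elim!: arrs_splitE)
  note a = is_functor_amap[OF T f(1)] is_functor_amap[OF S f(2)]
  show "amap ?E fs \<in> hom B (omap ?E (map2 (sdom B) (signs ?E) fs)) (omap ?E (map2 (scod B) (signs ?E) fs))"
    using a f sdom_Not(1,2)[of f1 "signs T"] by (simp add: combine_def Let_def fs hom_iff del: map_map)
  fix gs assume "gs \<in> arrs B (length (signs ?E))"
  then obtain g1 g2 where gs: "gs = g1 @ g2" and
    g: "g1 \<in> arrs B (length (signs T))" "g2 \<in> arrs B (length (signs S))"
    by (auto simp: combine_def Let_def elim!: arrs_splitE)
  note b = is_functor_amap[OF T g(1)] is_functor_amap[OF S g(2)]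
  assume "map2 (scod B) (signs ?E) fs = map2 (sdom B) (signs ?E) gs"
  then have e: "map2 (scod B) (signs T) g1 = map2 (sdom B) (signs T) f1"
    "map2 (scod B) (signs S) f2 = map2 (sdom B) (signs S) g2"
    using f g sdom_Not(1,2)[of f1 "signs T"] sdom_Not(1,2)[of g1 "signs T"]
    by (simp_all add: combine_def Let_def fs gs)
  show "amap ?E (scomps (signs ?E) gs fs) = amap ?E gs \<cdot> amap ?E fs"
    using f g sdom_Not(3)[of f1 "signs T" g1 "signs S" g2 f2]
      is_functor_Comp[OF T g(1) f(1) e(1)] is_functor_Comp[OF S f(2) g(2) e(2)] a b e exp_arr_Comp
    by (simp add: combine_def Let_def fs gs del: map_append upt_add_eq_append)
qed

lemma is_functor_funct: "is_functor B (funct B F)"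
proof (induction F)
  case Var
  show ?case
  proof (rule is_functorI)
    fix As :: "'o list"
    assume "As \<in> obs B (length (signs (funct B Var)))"
    then obtain A where "As = [A]" "A \<in> Ob B" by (auto simp: obs_def length_Suc_conv simp del: lengths)
    then show "omap (funct B Var) As \<in> Ob B"
      "amap (funct B Var) (map (Id B) As) = Id B (omap (funct B Var) As)" by simp_all
  next
    fix fs assume "fs \<in> arrs B (length (signs (funct B Var)))"
    then obtain f where f: "fs = [f]" "f \<in> Arr B" by (auto simp: arrs_def length_Suc_conv simp del: lengths)
    then show "amap (funct B Var) fs \<in> hom B
       (omap (funct B Var) (map2 (sdom B) (signs (funct B Var)) fs))
       (omap (funct B Var) (map2 (scod B) (signs (funct B Var)) fs))"
      by (simp add: hom_iff sdom_def scod_def)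
    fix gs assume "gs \<in> arrs B (length (signs (funct B Var)))"
    then obtain g where "gs = [g]" by (auto simp: arrs_def length_Suc_conv simp del: lengths)
    then show "amap (funct B Var) (scomps (signs (funct B Var)) gs fs) =
        amap (funct B Var) gs \<cdot> amap (funct B Var) fs"
      using f by (simp add: scomp_def)
  qed
next
  case One
  show ?case by (rule is_functorI) (auto simp: obs_def arrs_def hom_iff simp del: lengths)
next
  case Zero
  show ?case by (rule is_functorI) (auto simp: obs_def arrs_def hom_iff simp del: lengths)
next
  case (Tensor F G)
  show ?case unfolding funct.simps
    by (rule is_functor_combine[OF Tensor]) (simp_all add: hom_iff prod_arr_Id prod_arr_Comp)
next
  case (Oplus F G)
  show ?case unfolding funct.simps
    by (rule is_functor_combine[OF Oplus]) (simp_all add: hom_iff coprod_arr_Id coprod_arr_Comp)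
next
  case (Arrow F G)
  show ?case unfolding funct.simps by (rule is_functor_combine_exp[OF Arrow])
qed

section \<open>Parametricity of the canonical transformations\<close>


abbreviation initR where "initR \<equiv> graphR (Id B (Init B))"

primrec lift :: "fob \<Rightarrow> ('o, 'm) lrel list \<Rightarrow> ('o, 'm) lrel" where
  "lift Var Rs = hd Rs"
| "lift One Rs = termR"
| "lift Zero Rs = initR"
| "lift (F \<^bold>\<otimes> G) Rs = prodR (lift F (take (ar B F) Rs)) (lift G (drop (ar B F) Rs))"
| "lift (F \<^bold>\<oplus> G) Rs = sumR (lift F (take (ar B F) Rs)) (lift G (drop (ar B F) Rs))"
| "lift (F \<^bold>\<rightarrow> G) Rs = expR (lift F (take (ar B F) Rs)) (lift G (drop (ar B F) Rs))"

definition rels :: "nat \<Rightarrow> ('o, 'm) lrel list set" where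
  "rels n = {Rs. length Rs = n \<and> (\<forall>R \<in> set Rs. admissible R)}"

lemma rels_splitE:
  assumes "Rs \<in> rels (m + n)"
  obtains Rs1 Rs2 where "Rs = Rs1 @ Rs2" "Rs1 \<in> rels m" "Rs2 \<in> rels n"
proof (rule that)
  show "Rs = take m Rs @ drop m Rs" by simp
  show "take m Rs \<in> rels m" "drop m Rs \<in> rels n"
    using assms by (auto simp: rels_def dest: in_set_takeD in_set_dropD)
qed

lemma rels_length [simp]: "Rs \<in> rels n \<Longrightarrow> length Rs = n"
  by (simp add: rels_def)

lemma signs_combine [simp]: "signs (combine ls sto sta T S) = ls @ signs S"
  by (simp add: combine_def Let_def)

lemma ar_simps:
  "ar B (F \<^bold>\<otimes> G) = ar B F + ar B G" "ar B (F \<^bold>\<oplus> G) = ar B F + ar B G"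
  "ar B (F \<^bold>\<rightarrow> G) = ar B F + ar B G"
  by simp_all

lemma lift_Left_Right:
  "Rs \<in> rels (ar B F) \<Longrightarrow> Left (lift F Rs) = omap (funct B F) (map Left Rs) \<and>
    Right (lift F Rs) = omap (funct B F) (map Right Rs) \<and> admissible (lift F Rs)"
proof (induction F arbitrary: Rs)
  case Var
  then show ?case by (auto simp: rels_def length_Suc_conv simp del: rels_length)
next
  case (Tensor F G)
  from Tensor.prems obtain Rs1 Rs2 where "Rs = Rs1 @ Rs2" "Rs1 \<in> rels (ar B F)" "Rs2 \<in> rels (ar B G)"
    unfolding ar_simps by (rule rels_splitE)
  with Tensor.IH show ?case by (simp add: combine_def Let_def admissible_prodR)
next
  case (Oplus F G)
  from Oplus.prems obtain Rs1 Rs2 where "Rs = Rs1 @ Rs2" "Rs1 \<in> rels (ar B F)" "Rs2 \<in> rels (ar B G)"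
    unfolding ar_simps by (rule rels_splitE)
  with Oplus.IH show ?case by (simp add: combine_def Let_def admissible_sumR)
next
  case (Arrow F G)
  from Arrow.prems obtain Rs1 Rs2 where "Rs = Rs1 @ Rs2" "Rs1 \<in> rels (ar B F)" "Rs2 \<in> rels (ar B G)"
    unfolding ar_simps by (rule rels_splitE)
  with Arrow.IH show ?case by (simp add: combine_def Let_def admissible_expR)
qed (simp_all add: admissible_termR admissible_graphR)

lemma admissible_lift: "Rs \<in> rels (ar B F) \<Longrightarrow> admissible (lift F Rs)"
  and lift_sides: "Rs \<in> rels (ar B F) \<Longrightarrow> omap (funct B F) (map Left Rs) = Left (lift F Rs)"
    "Rs \<in> rels (ar B F) \<Longrightarrow> omap (funct B F) (map Right Rs) = Right (lift F Rs)"
  by (simp_all add: lift_Left_Right)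

text \<open>Parametricity, the property that takes the place of dinaturality in the induction.  The relations
  are indexed by the components of the graph, just as the objects are in a family.\<close>

definition rel_family :: "fob \<Rightarrow> fob \<Rightarrow> graph \<Rightarrow> ('o list \<Rightarrow> 'm) \<Rightarrow> bool" where
  "rel_family F G \<Gamma> \<alpha> \<longleftrightarrow> (\<forall>Rs \<in> rels (ncomp \<Gamma>).
     morph (lift F (reindex Rs (lcomp \<Gamma>))) (lift G (reindex Rs (rcomp \<Gamma>)))
       (\<alpha> (map Left Rs)) (\<alpha> (map Right Rs)))"

lemma map_sides_obs: "Rs \<in> rels n \<Longrightarrow> map Left Rs \<in> obs B n" "Rs \<in> rels n \<Longrightarrow> map Right Rs \<in> obs B n"
  by (auto simp: rels_def obs_def simp del: rels_length lengths)

lemma length_reindex [simp]: "length (reindex As cs) = length cs"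
  by (simp add: reindex_def)

lemma reindex_append [simp]: "reindex As (cs @ ds) = reindex As cs @ reindex As ds"
  by (simp add: reindex_def)

lemma reindex_Nil [simp]: "reindex As [] = []"
  by (simp add: reindex_def)

lemma reindex_upt: "b \<le> length As \<Longrightarrow> reindex As [a..<b] = take (b - a) (drop a As)"
  by (rule nth_equalityI) (auto simp: reindex_def)

lemma map_reindex: "set cs \<subseteq> {..<length As} \<Longrightarrow> map h (reindex As cs) = reindex (map h As) cs"
  by (auto simp: reindex_def)

lemma reindex_rels: "Rs \<in> rels n \<Longrightarrow> set cs \<subseteq> {..<n} \<Longrightarrow> reindex Rs cs \<in> rels (length cs)"
  by (auto simp: rels_def reindex_def simp del: rels_length)

lemma set_reindex: "set cs \<subseteq> {..<length As} \<Longrightarrow> set (reindex As cs) \<subseteq> set As"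
  by (auto simp: reindex_def)

lemma reindex_reindex:
  "set cs \<subseteq> {..<length ds} \<Longrightarrow> reindex (reindex As ds) cs = reindex As (map (\<lambda>c. ds ! c) cs)"
  by (auto simp: reindex_def)

lemma reindex_append_left:
  "set cs \<subseteq> {..<length As} \<Longrightarrow> reindex (As @ Cs) cs = reindex As cs"
  by (auto simp: reindex_def nth_append)

lemma reindex_append_right: "n = length As \<Longrightarrow> reindex (As @ Cs) (map (\<lambda>c. n + c) cs) = reindex Cs cs"
  by (auto simp: reindex_def)

lemma reindex_map_upt:
  "set cs \<subseteq> {..<n} \<Longrightarrow> reindex As (map r cs) = reindex (reindex As (map r [0..<n])) cs"
  by (auto simp: reindex_reindex subset_iff intro!: arg_cong[where f = "reindex As"])

text \<open>For primitive transformations, a list of relations on the components splits into lists for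
  the indices, and the values of the functors at the tuples of sides are the sides of the lifted relations.\<close>

lemma rel_familyI1:
  assumes "\<And>Rs. Rs \<in> rels (ar B H) \<Longrightarrow>
    morph (lift F (reindex Rs ls)) (lift G (reindex Rs rs)) (h (Left (lift H Rs))) (h (Right (lift H Rs)))"
  shows "rel_family F G (fgraph B F G (ar B H) ls rs) (family1 B h H)"
  using assms by (simp add: rel_family_def fgraph_def family1_def map_sides_obs lift_sides)

lemma rel_familyI2:
  assumes "\<And>Rs Ss. Rs \<in> rels (ar B H) \<Longrightarrow> Ss \<in> rels (ar B J) \<Longrightarrow>
    morph (lift F (reindex (Rs @ Ss) ls)) (lift G (reindex (Rs @ Ss) rs))
      (h (Left (lift H Rs)) (Left (lift J Ss))) (h (Right (lift H Rs)) (Right (lift J Ss)))"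
  shows "rel_family F G (fgraph B F G (ar B H + ar B J) ls rs) (family2 B h H J)"
  unfolding rel_family_def
proof
  fix Rs assume "Rs \<in> rels (ncomp (fgraph B F G (ar B H + ar B J) ls rs))"
  then obtain Rs1 Rs2 where R: "Rs = Rs1 @ Rs2" "Rs1 \<in> rels (ar B H)" "Rs2 \<in> rels (ar B J)"
    by (auto simp: fgraph_def elim: rels_splitE)
  have "map Left Rs1 @ map Left Rs2 \<in> obs B (ar B H + ar B J)"
    "map Right Rs1 @ map Right Rs2 \<in> obs B (ar B H + ar B J)"
    using map_sides_obs[OF R(2)] map_sides_obs[OF R(3)] by auto
  then show "morph (lift F (reindex Rs (lcomp (fgraph B F G (ar B H + ar B J) ls rs))))
      (lift G (reindex Rs (rcomp (fgraph B F G (ar B H + ar B J) ls rs))))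
      (family2 B h H J (map Left Rs)) (family2 B h H J (map Right Rs))"
    using assms[OF R(2,3)] R by (simp add: fgraph_def family2_def lift_sides del: obs_append)
qed

lemma rel_familyI3:
  assumes "\<And>Rs Ss Ts. Rs \<in> rels (ar B H) \<Longrightarrow> Ss \<in> rels (ar B J) \<Longrightarrow> Ts \<in> rels (ar B K) \<Longrightarrow>
    morph (lift F (reindex (Rs @ Ss @ Ts) ls)) (lift G (reindex (Rs @ Ss @ Ts) rs))
      (h (Left (lift H Rs)) (Left (lift J Ss)) (Left (lift K Ts)))
      (h (Right (lift H Rs)) (Right (lift J Ss)) (Right (lift K Ts)))"
  shows "rel_family F G (fgraph B F G (ar B H + ar B J + ar B K) ls rs) (family3 B h H J K)"
  unfolding rel_family_def
proof
  fix Rs assume "Rs \<in> rels (ncomp (fgraph B F G (ar B H + ar B J + ar B K) ls rs))"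
  then obtain Rs1 Rs2 Rs3 where R: "Rs = Rs1 @ Rs2 @ Rs3" "Rs1 \<in> rels (ar B H)" "Rs2 \<in> rels (ar B J)"
    "Rs3 \<in> rels (ar B K)"
    by (auto simp: fgraph_def add.assoc elim!: rels_splitE)
  have "map Left Rs1 @ map Left Rs2 @ map Left Rs3 \<in> obs B (ar B H + ar B J + ar B K)"
    "map Right Rs1 @ map Right Rs2 @ map Right Rs3 \<in> obs B (ar B H + ar B J + ar B K)"
    using map_sides_obs[OF R(2)] map_sides_obs[OF R(3)] map_sides_obs[OF R(4)]
    by (auto simp: add.assoc)
  then show "morph (lift F (reindex Rs (lcomp (fgraph B F G (ar B H + ar B J + ar B K) ls rs))))
      (lift G (reindex Rs (rcomp (fgraph B F G (ar B H + ar B J + ar B K) ls rs))))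
      (family3 B h H J K (map Left Rs)) (family3 B h H J K (map Right Rs))"
    using assms[OF R(2-4)] R by (simp add: fgraph_def family3_def lift_sides del: obs_append)
qed

lemma graph_of_canonical:
  "canonical B F G \<Gamma> \<alpha> \<Longrightarrow> is_graph \<Gamma> \<and> lsign \<Gamma> = sg B F \<and> rsign \<Gamma> = sg B G"
proof (induction rule: canonical.induct)
  case (sub F G \<Gamma> \<alpha> I r k)
  have "r ` {..<ncomp \<Gamma>} = {..<k}" using sub.hyps(2) by (simp add: merging_def)
  with sub.IH show ?case by (force simp: relabel_def is_graph_def)
next
  case (comp F G \<Phi> \<alpha> H \<Psi> \<beta> \<rho> \<sigma> k)
  have "case_sum \<rho> \<sigma> ` ({..<ncomp \<Phi>} <+> {..<ncomp \<Psi>}) = {..<k}"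
    using comp.hyps(3) by (simp add: glueing_def Let_def)
  then have "\<rho> ` {..<ncomp \<Phi>} \<subseteq> {..<k}" "\<sigma> ` {..<ncomp \<Psi>} \<subseteq> {..<k}"
    unfolding Plus_def by (auto simp: image_Un image_image)
  with comp.IH show ?case by (force simp: composite_def is_graph_def)
qed (auto simp: is_graph_def fgraph_def disjoint_union_def inverted_def)

text \<open>One argument serves the three binary constructors: \<open>op\<close> stands for \<open>prodR\<close>, \<open>sumR\<close> or
  \<open>expR\<close>, and \<open>c\<close> for the corresponding operation on arrows.\<close>

lemma rel_family_disjoint_union:
  assumes g: "is_graph \<Phi>" "is_graph \<Psi>" "length (lcomp \<Phi>) = ar B F" "length (rcomp \<Phi>) = ar B G"
    and 1: "\<And>Rs Ss. Rs \<in> rels (ncomp \<Phi>) \<Longrightarrow> Ss \<in> rels (ncomp \<Psi>) \<Longrightarrow>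
    morph (op (lift F (reindex Rs (lcomp \<Phi>))) (lift H (reindex Ss (lcomp \<Psi>))))
      (op (lift G (reindex Rs (rcomp \<Phi>))) (lift J (reindex Ss (rcomp \<Psi>))))
      (c (\<alpha> (map Left Rs)) (\<beta> (map Left Ss))) (c (\<alpha> (map Right Rs)) (\<beta> (map Right Ss)))"
    and F': "\<And>Rs. lift F' Rs = op (lift F (take (ar B F) Rs)) (lift H (drop (ar B F) Rs))"
    and G': "\<And>Rs. lift G' Rs = op (lift G (take (ar B G) Rs)) (lift J (drop (ar B G) Rs))"
  shows "rel_family F' G' (disjoint_union \<Phi> \<Psi>)
    (\<lambda>As \<in> obs B (ncomp \<Phi> + ncomp \<Psi>). c (\<alpha> (take (ncomp \<Phi>) As)) (\<beta> (drop (ncomp \<Phi>) As)))"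
  unfolding rel_family_def
proof
  fix Rs assume "Rs \<in> rels (ncomp (disjoint_union \<Phi> \<Psi>))"
  then obtain Rs1 Rs2 where R: "Rs = Rs1 @ Rs2" "Rs1 \<in> rels (ncomp \<Phi>)" "Rs2 \<in> rels (ncomp \<Psi>)"
    by (auto simp: disjoint_union_def elim: rels_splitE)
  have o: "map Left Rs1 @ map Left Rs2 \<in> obs B (ncomp \<Phi> + ncomp \<Psi>)"
    "map Right Rs1 @ map Right Rs2 \<in> obs B (ncomp \<Phi> + ncomp \<Psi>)"
    using map_sides_obs[OF R(2)] map_sides_obs[OF R(3)] by auto
  have r: "reindex Rs (lcomp (disjoint_union \<Phi> \<Psi>)) = reindex Rs1 (lcomp \<Phi>) @ reindex Rs2 (lcomp \<Psi>)"
    "reindex Rs (rcomp (disjoint_union \<Phi> \<Psi>)) = reindex Rs1 (rcomp \<Phi>) @ reindex Rs2 (rcomp \<Psi>)"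
    using R g by (simp_all add: disjoint_union_def is_graph_def reindex_append_left reindex_append_right)
  show "morph (lift F' (reindex Rs (lcomp (disjoint_union \<Phi> \<Psi>))))
      (lift G' (reindex Rs (rcomp (disjoint_union \<Phi> \<Psi>))))
      ((\<lambda>As \<in> obs B (ncomp \<Phi> + ncomp \<Psi>). c (\<alpha> (take (ncomp \<Phi>) As)) (\<beta> (drop (ncomp \<Phi>) As))) (map Left Rs))
      ((\<lambda>As \<in> obs B (ncomp \<Phi> + ncomp \<Psi>). c (\<alpha> (take (ncomp \<Phi>) As)) (\<beta> (drop (ncomp \<Phi>) As))) (map Right Rs))"
    unfolding r F' G' using 1[OF R(2,3)] o R g by (simp del: obs_append)
qed

text \<open>The components of \<open>\<Phi>\<close> and \<open>\<Psi>\<close> at a shared place get the same number, so the two ways of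
  assigning relations to the places of the intermediate functor agree; then preserving relations is
  composed with preserving relations.\<close>

lemma rel_family_comp:
  assumes gF: "is_graph \<Phi>" and gS: "is_graph \<Psi>" and len: "length (rcomp \<Phi>) = length (lcomp \<Psi>)"
    and a: "rel_family F G \<Phi> \<alpha>" and b: "rel_family G H \<Psi> \<beta>" and gl: "glueing \<Phi> \<Psi> \<rho> \<sigma> k"
  shows "rel_family F H (composite \<Phi> \<Psi> \<rho> \<sigma> k)
      (\<lambda>As \<in> obs B k. \<beta> (reindex As (map \<sigma> [0..<ncomp \<Psi>])) \<cdot> \<alpha> (reindex As (map \<rho> [0..<ncomp \<Phi>])))"
  unfolding rel_family_def
proof
  fix Rs assume "Rs \<in> rels (ncomp (composite \<Phi> \<Psi> \<rho> \<sigma> k))"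
  then have R: "Rs \<in> rels k" by (simp add: composite_def)
  let ?P = "reindex Rs (map \<rho> [0..<ncomp \<Phi>])" and ?S = "reindex Rs (map \<sigma> [0..<ncomp \<Psi>])"
  let ?V = "{..<ncomp \<Phi>} <+> {..<ncomp \<Psi>}"
  have im: "case_sum \<rho> \<sigma> ` ?V = {..<k}"
    and cls: "\<And>u v. u \<in> ?V \<Longrightarrow> v \<in> ?V \<Longrightarrow> (u, v) \<in> (shared \<Phi> \<Psi> \<union> (shared \<Phi> \<Psi>)\<inverse>)\<^sup>* \<Longrightarrow>
      case_sum \<rho> \<sigma> u = case_sum \<rho> \<sigma> v"
    using gl by (simp_all add: glueing_def Let_def)
  have rng: "\<rho> ` {..<ncomp \<Phi>} \<subseteq> {..<k}" "\<sigma> ` {..<ncomp \<Psi>} \<subseteq> {..<k}"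
    using im unfolding Plus_def by (auto simp: image_Un image_image)
  have eq: "\<rho> (rcomp \<Phi> ! j) = \<sigma> (lcomp \<Psi> ! j)" if j: "j < length (rcomp \<Phi>)" for j
  proof -
    have "rcomp \<Phi> ! j < ncomp \<Phi>" "lcomp \<Psi> ! j < ncomp \<Psi>"
      using j len gF gS nth_mem[of j "rcomp \<Phi>"] nth_mem[of j "lcomp \<Psi>"]
      by (auto simp: is_graph_def simp del: nth_mem)
    moreover have "(Inl (rcomp \<Phi> ! j), Inr (lcomp \<Psi> ! j)) \<in> shared \<Phi> \<Psi>"
      using j gF by (auto simp: shared_def is_graph_def)
    ultimately show ?thesis
      using cls[OF InlI InrI, of "rcomp \<Phi> ! j" "lcomp \<Psi> ! j"] by (simp add: r_into_rtrancl)
  qed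
  have P: "?P \<in> rels (ncomp \<Phi>)" and S: "?S \<in> rels (ncomp \<Psi>)"
    using reindex_rels[OF R, of "map \<rho> [0..<ncomp \<Phi>]"] reindex_rels[OF R, of "map \<sigma> [0..<ncomp \<Psi>]"] rng
    by (auto simp: atLeast0LessThan)
  have "map \<rho> (rcomp \<Phi>) = map \<sigma> (lcomp \<Psi>)"
    by (rule nth_equalityI) (use eq len in auto)
  then have "reindex ?P (rcomp \<Phi>) = reindex ?S (lcomp \<Psi>)"
    using reindex_map_upt[of "rcomp \<Phi>" "ncomp \<Phi>" Rs \<rho>] reindex_map_upt[of "lcomp \<Psi>" "ncomp \<Psi>" Rs \<sigma>] gF gS
    by (simp add: is_graph_def)
  moreover have "reindex Rs (map \<rho> (lcomp \<Phi>)) = reindex ?P (lcomp \<Phi>)"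
    "reindex Rs (map \<sigma> (rcomp \<Psi>)) = reindex ?S (rcomp \<Psi>)"
    using gF gS by (auto simp: is_graph_def intro!: reindex_map_upt)
  moreover have "map Left ?P = reindex (map Left Rs) (map \<rho> [0..<ncomp \<Phi>])"
    "map Right ?P = reindex (map Right Rs) (map \<rho> [0..<ncomp \<Phi>])"
    "map Left ?S = reindex (map Left Rs) (map \<sigma> [0..<ncomp \<Psi>])"
    "map Right ?S = reindex (map Right Rs) (map \<sigma> [0..<ncomp \<Psi>])"
    using R rng by (intro map_reindex; auto simp: atLeast0LessThan)+
  moreover have "morph (lift F (reindex ?P (lcomp \<Phi>))) (lift G (reindex ?P (rcomp \<Phi>)))
      (\<alpha> (map Left ?P)) (\<alpha> (map Right ?P))"
    using a P by (simp add: rel_family_def)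
  moreover have "morph (lift G (reindex ?S (lcomp \<Psi>))) (lift H (reindex ?S (rcomp \<Psi>)))
      (\<beta> (map Left ?S)) (\<beta> (map Right ?S))"
    using b S by (simp add: rel_family_def)
  ultimately show "morph (lift F (reindex Rs (lcomp (composite \<Phi> \<Psi> \<rho> \<sigma> k))))
      (lift H (reindex Rs (rcomp (composite \<Phi> \<Psi> \<rho> \<sigma> k))))
      ((\<lambda>As \<in> obs B k. \<beta> (reindex As (map \<sigma> [0..<ncomp \<Psi>])) \<cdot> \<alpha> (reindex As (map \<rho> [0..<ncomp \<Phi>]))) (map Left Rs))
      ((\<lambda>As \<in> obs B k. \<beta> (reindex As (map \<sigma> [0..<ncomp \<Psi>])) \<cdot> \<alpha> (reindex As (map \<rho> [0..<ncomp \<Phi>]))) (map Right Rs))"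
    using map_sides_obs[OF R] by (simp add: composite_def morph_Comp)
qed

lemma rel_family_sub:
  assumes g: "is_graph \<Gamma>" and a: "rel_family F G \<Gamma> \<alpha>" and r: "r ` {..<ncomp \<Gamma>} \<subseteq> {..<k}"
  shows "rel_family F G (relabel \<Gamma> r k) (\<lambda>As \<in> obs B k. \<alpha> (reindex As (map r [0..<ncomp \<Gamma>])))"
  unfolding rel_family_def
proof
  fix Rs assume "Rs \<in> rels (ncomp (relabel \<Gamma> r k))"
  then have R: "Rs \<in> rels k" by (simp add: relabel_def)
  let ?P = "reindex Rs (map r [0..<ncomp \<Gamma>])"
  have P: "?P \<in> rels (ncomp \<Gamma>)"
    using reindex_rels[OF R, of "map r [0..<ncomp \<Gamma>]"] r by (auto simp: atLeast0LessThan)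
  have "reindex Rs (map r (lcomp \<Gamma>)) = reindex ?P (lcomp \<Gamma>)"
    "reindex Rs (map r (rcomp \<Gamma>)) = reindex ?P (rcomp \<Gamma>)"
    using g by (auto simp: is_graph_def intro!: reindex_map_upt)
  moreover have "map Left ?P = reindex (map Left Rs) (map r [0..<ncomp \<Gamma>])"
    "map Right ?P = reindex (map Right Rs) (map r [0..<ncomp \<Gamma>])"
    using R r by (intro map_reindex; auto simp: atLeast0LessThan)+
  moreover have "morph (lift F (reindex ?P (lcomp \<Gamma>))) (lift G (reindex ?P (rcomp \<Gamma>)))
      (\<alpha> (map Left ?P)) (\<alpha> (map Right ?P))"
    using a P by (simp add: rel_family_def)
  ultimately show "morph (lift F (reindex Rs (lcomp (relabel \<Gamma> r k))))
      (lift G (reindex Rs (rcomp (relabel \<Gamma> r k))))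
      ((\<lambda>As \<in> obs B k. \<alpha> (reindex As (map r [0..<ncomp \<Gamma>]))) (map Left Rs))
      ((\<lambda>As \<in> obs B k. \<alpha> (reindex As (map r [0..<ncomp \<Gamma>]))) (map Right Rs))"
    using map_sides_obs[OF R] by (simp add: relabel_def)
qed

subsection \<open>Special morphisms\<close>

lemma morph_delta_inv:
  assumes "admissible R"
  shows "morph R (prodR R termR) (sp_delta_inv B (Left R)) (sp_delta_inv B (Right R))"
  unfolding sp_delta_inv_def by (intro morph_pair morph_Id morph_k assms)

lemma morph_delta:
  assumes "admissible R"
  shows "morph (prodR R termR) R (sp_delta B (Left R)) (sp_delta B (Right R))"
  using morph_Proj1[OF assms admissible_termR] by (simp add: sp_delta_def)

lemma morph_w:
  assumes "admissible R"
  shows "morph R (prodR R R) (sp_w B (Left R)) (sp_w B (Right R))"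
  unfolding sp_w_def by (intro morph_pair morph_Id assms)

lemma morph_m:
  assumes "admissible R"
  shows "morph (sumR R R) R (sp_m B (Left R)) (sp_m B (Right R))"
  unfolding sp_m_def by (intro morph_copair morph_Id assms)

lemma morph_c:
  assumes "admissible R" "admissible S"
  shows "morph (prodR R S) (prodR S R) (sp_c B (Left R) (Left S)) (sp_c B (Right R) (Right S))"
  unfolding sp_c_def by (intro morph_pair morph_Proj1 morph_Proj2 assms)

lemma morph_b_right:
  assumes R: "admissible R" and S: "admissible S" and T: "admissible T"
  shows "morph (prodR R (prodR S T)) (prodR (prodR R S) T)
    (sp_b_right B (Left R) (Left S) (Left T)) (sp_b_right B (Right R) (Right S) (Right T))"
proof -
  note 1 = morph_Proj1[OF R admissible_prodR[OF S T]] and 2 = morph_Proj2[OF R admissible_prodR[OF S T]]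
  show ?thesis
    using morph_pair[OF morph_pair[OF 1 morph_Comp[OF 2 morph_Proj1[OF S T]]]
        morph_Comp[OF 2 morph_Proj2[OF S T]]]
    by (simp add: sp_b_right_def Let_def)
qed

lemma morph_b_left:
  assumes R: "admissible R" and S: "admissible S" and T: "admissible T"
  shows "morph (prodR (prodR R S) T) (prodR R (prodR S T))
    (sp_b_left B (Left R) (Left S) (Left T)) (sp_b_left B (Right R) (Right S) (Right T))"
proof -
  note 1 = morph_Proj1[OF admissible_prodR[OF R S] T] and 2 = morph_Proj2[OF admissible_prodR[OF R S] T]
  show ?thesis
    using morph_pair[OF morph_Comp[OF 1 morph_Proj1[OF R S]]
        morph_pair[OF morph_Comp[OF 1 morph_Proj2[OF R S]] 2]]
    by (simp add: sp_b_left_def Let_def)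
qed

lemma morph_eta:
  assumes R: "admissible R" and S: "admissible S"
  shows "morph S (expR R (prodR R S)) (sp_eta B (Left R) (Left S)) (sp_eta B (Right R) (Right S))"
  using morph_curry[OF R S morph_Id[OF admissible_prodR[OF R S]]] by (simp add: sp_eta_def)

lemma rel_family_canonical: "canonical B F G \<Gamma> \<alpha> \<Longrightarrow> rel_family F G \<Gamma> \<alpha>"
proof (induction rule: canonical.induct)
  case (ident F)
  show ?case by (rule rel_familyI1) (simp add: reindex_upt morph_Id admissible_lift)
next
  case (delta F)
  show ?case by (rule rel_familyI1) (simp add: reindex_upt morph_delta admissible_lift)
next
  case (delta_inv F)
  show ?case by (rule rel_familyI1) (simp add: reindex_upt morph_delta_inv admissible_lift)
next
  case (b_right F G H)
  show ?case by (rule rel_familyI3) (simp add: reindex_upt morph_b_right admissible_lift)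
next
  case (b_left F G H)
  show ?case by (rule rel_familyI3) (simp add: reindex_upt morph_b_left admissible_lift)
next
  case (symm F G)
  show ?case by (rule rel_familyI2) (simp add: reindex_upt morph_c admissible_lift)
next
  case (diag F)
  show ?case by (rule rel_familyI1) (simp add: reindex_upt morph_w admissible_lift)
next
  case (terminal F)
  show ?case by (rule rel_familyI1) (simp add: reindex_upt morph_k admissible_lift)
next
  case (initial F)
  show ?case by (rule rel_familyI1) (simp add: reindex_upt morph_l admissible_lift)
next
  case (inj1 F G)
  show ?case by (rule rel_familyI2) (simp add: reindex_upt morph_Inj1 admissible_lift)
next
  case (inj2 G F)
  show ?case by (rule rel_familyI2) (simp add: reindex_upt morph_Inj2 admissible_lift)
next
  case (codiag F)
  show ?case by (rule rel_familyI1) (simp add: reindex_upt morph_m admissible_lift)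
next
  case (counit_exp F G)
  show ?case by (rule rel_familyI2) (simp add: reindex_upt morph_Eval admissible_lift)
next
  case (unit_exp G F)
  show ?case by (rule rel_familyI2) (simp add: reindex_upt morph_eta admissible_lift)
next
  case (sub F G \<Gamma> \<alpha> I r k)
  then show ?case
    using graph_of_canonical[OF sub.hyps(1)] by (intro rel_family_sub) (auto simp: merging_def)
next
  case (tensor F G \<Phi> \<alpha> H J \<Psi> \<beta>)
  have g: "is_graph \<Phi>" "is_graph \<Psi>" "length (lcomp \<Phi>) = ar B F" "length (rcomp \<Phi>) = ar B G"
    using graph_of_canonical[OF tensor.hyps(1)] graph_of_canonical[OF tensor.hyps(2)]
    by (auto simp: is_graph_def)
  show ?case
    by (rule rel_family_disjoint_union[OF g]) (use tensor.IH in \<open>simp_all add: rel_family_def morph_prod_arr\<close>)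
next
  case (oplus F G \<Phi> \<alpha> H J \<Psi> \<beta>)
  have g: "is_graph \<Phi>" "is_graph \<Psi>" "length (lcomp \<Phi>) = ar B F" "length (rcomp \<Phi>) = ar B G"
    using graph_of_canonical[OF oplus.hyps(1)] graph_of_canonical[OF oplus.hyps(2)]
    by (auto simp: is_graph_def)
  show ?case
    by (rule rel_family_disjoint_union[OF g]) (use oplus.IH in \<open>simp_all add: rel_family_def morph_coprod_arr\<close>)
next
  case (arrow F G \<Phi> \<alpha> H J \<Psi> \<beta>)
  have g: "is_graph (inverted \<Phi>)" "is_graph \<Psi>" "length (lcomp (inverted \<Phi>)) = ar B G"
    "length (rcomp (inverted \<Phi>)) = ar B F"
    using graph_of_canonical[OF arrow.hyps(1)] graph_of_canonical[OF arrow.hyps(2)]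
    by (auto simp: is_graph_def inverted_def)
  have n: "ncomp (inverted \<Phi>) = ncomp \<Phi>" by (simp add: inverted_def)
  show ?case
    by (rule rel_family_disjoint_union[OF g, where c = "exp_arr B" and \<alpha> = \<alpha> and \<beta> = \<beta> and op = expR, unfolded n])
      (use arrow.IH in \<open>simp_all add: rel_family_def morph_exp_arr inverted_def\<close>)
next
  case (comp F G \<Phi> \<alpha> H \<Psi> \<beta> \<rho> \<sigma> k)
  then show ?case
    using graph_of_canonical[OF comp.hyps(1)] graph_of_canonical[OF comp.hyps(2)]
    by (intro rel_family_comp) (auto simp: is_graph_def)
qed

section \<open>From relations to dinaturality\<close>


text \<open>The pair \<open>w\<close>, \<open>z\<close> is the lower bound of \<open>R\<close>, and the pairs that \<open>p\<close> and \<open>q\<close> equalize form the upper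
  bound.  When \<open>R\<close> is a functor \<open>F\<close> lifted to graphs of arrows \<open>A \<turnstile> C\<close>, these are
  \<open>p : F(A,A) \<turnstile> F(A,C)\<close>, \<open>q : F(C,C) \<turnstile> F(A,C)\<close>, \<open>w : F(C,A) \<turnstile> F(A,A)\<close>, \<open>z : F(C,A) \<turnstile> F(C,C)\<close>.\<close>

definition sandwiched :: "('o, 'm) lrel \<Rightarrow> 'm \<Rightarrow> 'm \<Rightarrow> 'm \<Rightarrow> 'm \<Rightarrow> bool" where
  "sandwiched R p q w z \<longleftrightarrow> admissible R \<and>
     p \<in> hom B (Left R) (Cod B q) \<and> q \<in> hom B (Right R) (Cod B q) \<and>
     w \<in> hom B (Dom B z) (Left R) \<and> z \<in> hom B (Dom B z) (Right R) \<and>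
     Rel R (Dom B z) w z \<and> (\<forall>D x y. Rel R D x y \<longrightarrow> p \<cdot> x = q \<cdot> y)"

lemma sandwichedD:
  assumes "sandwiched R p q w z"
  shows "admissible R" "p \<in> Arr B" "Dom B p = Left R" "Cod B p = Cod B q"
    "q \<in> Arr B" "Dom B q = Right R"
    "w \<in> Arr B" "Dom B w = Dom B z" "Cod B w = Left R"
    "z \<in> Arr B" "Cod B z = Right R"
  using assms by (simp_all add: sandwiched_def hom_iff)

lemma sandwiched_lower: "sandwiched R p q w z \<Longrightarrow> Rel R (Dom B z) w z"
  and sandwiched_upper: "sandwiched R p q w z \<Longrightarrow> Rel R D x y \<Longrightarrow> p \<cdot> x = q \<cdot> y"
  by (simp_all add: sandwiched_def)

lemma sandwichedI:
  assumes "admissible R" "p \<in> Arr B" "Dom B p = Left R" "Cod B p = Cod B q"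
    "q \<in> Arr B" "Dom B q = Right R"
    "w \<in> Arr B" "Dom B w = Dom B z" "Cod B w = Left R"
    "z \<in> Arr B" "Cod B z = Right R"
    "Rel R (Dom B z) w z" "\<And>D x y. Rel R D x y \<Longrightarrow> p \<cdot> x = q \<cdot> y"
  shows "sandwiched R p q w z"
  using assms by (simp add: sandwiched_def hom_iff)

lemma sandwiched_graphR:
  assumes "f \<in> Arr B"
  shows "sandwiched (graphR f) f (Id B (Cod B f)) (Id B (Dom B f)) f"
  by (rule sandwichedI) (use assms admissible_graphR in \<open>auto simp: graphR_def hom_iff\<close>)

lemma sandwiched_termR:
  "sandwiched termR (Id B (Term B)) (Id B (Term B)) (Id B (Term B)) (Id B (Term B))"
proof (rule sandwichedI)
  fix D x y assume "Rel termR D x y"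
  then have "x \<in> hom B D (Term B)" "y \<in> hom B D (Term B)" "D \<in> Ob B"
    by (auto simp: termR_def hom_iff)
  then have "x = y" using Term_universal[of D] by auto
  then show "Id B (Term B) \<cdot> x = Id B (Term B) \<cdot> y" by simp
qed (simp_all add: admissible_termR, simp add: termR_def hom_iff)

lemma sandwiched_prodR:
  assumes R: "sandwiched R p q w z" and S: "sandwiched S p' q' w' z'"
  shows "sandwiched (prodR R S) (prod_arr B p p') (prod_arr B q q') (prod_arr B w w') (prod_arr B z z')"
proof (rule sandwichedI)
  note r = sandwichedD[OF R] and s = sandwichedD[OF S]
  show "Rel (prodR R S) (Dom B (prod_arr B z z')) (prod_arr B w w') (prod_arr B z z')"
    using r s admissible_restrict[OF r(1) sandwiched_lower[OF R], of "Proj1 B (Dom B z) (Dom B z')"]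
      admissible_restrict[OF s(1) sandwiched_lower[OF S], of "Proj2 B (Dom B z) (Dom B z')"]
    by (simp add: prodR_def hom_iff prod_arr_def)
  fix D x y assume xy: "Rel (prodR R S) D x y"
  note h = admissible_hom[OF admissible_prodR[OF r(1) s(1)] xy]
  have "p \<cdot> Proj1 B (Left R) (Left S) \<cdot> x = q \<cdot> Proj1 B (Right R) (Right S) \<cdot> y"
    "p' \<cdot> Proj2 B (Left R) (Left S) \<cdot> x = q' \<cdot> Proj2 B (Right R) (Right S) \<cdot> y"
    using xy by (auto simp: prodR_def intro: sandwiched_upper[OF R] sandwiched_upper[OF S])
  then show "prod_arr B p p' \<cdot> x = prod_arr B q q' \<cdot> y"
    using h r s by (simp add: prod_arr_def)
qed (use sandwichedD[OF R] sandwichedD[OF S] in \<open>simp_all add: admissible_prodR\<close>)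

text \<open>The lower bound is glued from the lower bounds of \<open>R\<close> and \<open>S\<close> along the injections; the
  upper bound holds by induction on the generation of the relation, arrows out of a coproduct
  being determined by their restrictions.\<close>

lemma sandwiched_sumR:
  assumes R: "sandwiched R p q w z" and S: "sandwiched S p' q' w' z'"
  shows "sandwiched (sumR R S) (coprod_arr B p p') (coprod_arr B q q') (coprod_arr B w w') (coprod_arr B z z')"
proof (rule sandwichedI)
  note r = sandwichedD[OF R] and s = sandwichedD[OF S]
  have "Rel (sumR R S) (Coprod B (Dom B z) (Dom B z')) (coprod_arr B w w') (coprod_arr B z z')"
    using sumRel.inj1[OF sandwiched_lower[OF R], of S] sumRel.inj2[OF sandwiched_lower[OF S], of R] r s
    by (intro admissible_Coprod admissible_sumR) (simp_all add: coprod_arr_def, simp_all add: sumR_def)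
  then show "Rel (sumR R S) (Dom B (coprod_arr B z z')) (coprod_arr B w w') (coprod_arr B z z')"
    using r s by simp
  fix D x y assume "Rel (sumR R S) D x y"
  then have "sumRel R S D x y" by (simp add: sumR_def)
  then show "coprod_arr B p p' \<cdot> x = coprod_arr B q q' \<cdot> y"
  proof (induction rule: sumRel.induct)
    case (inj1 D x y)
    then show ?case
      using admissible_hom[OF r(1) inj1] r s sandwiched_upper[OF R inj1] by (simp add: coprod_arr_def)
  next
    case (inj2 D x y)
    then show ?case
      using admissible_hom[OF s(1) inj2] r s sandwiched_upper[OF S inj2] by (simp add: coprod_arr_def)
  next
    case (restrict D x y e)
    have "x \<in> hom B D (Coprod B (Left R) (Left S))" "y \<in> hom B D (Coprod B (Right R) (Right S))"
      using sumRel_hom[OF r(1) s(1) restrict.hyps(1)] by simp_all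
    then have "(coprod_arr B p p' \<cdot> x) \<cdot> e = coprod_arr B p p' \<cdot> x \<cdot> e"
      "(coprod_arr B q q' \<cdot> y) \<cdot> e = coprod_arr B q q' \<cdot> y \<cdot> e"
      using restrict.hyps r s by (simp_all add: hom_iff)
    then show ?case using restrict.IH by simp
  next
    case (glue U V x y)
    show ?case
      by (rule copair_eqI[where A = U and C = V]) (use glue r s in \<open>simp_all add: hom_iff\<close>)
  next
    case (glue_empty x y)
    show ?case by (rule init_eqI) (use glue_empty r s in \<open>simp_all add: hom_iff\<close>)
  qed
qed (use sandwichedD[OF R] sandwichedD[OF S] in \<open>simp_all add: admissible_sumR\<close>)

text \<open>The two bounds exchange their roles in the contravariant argument: the lower bound of the
  exponential uses the upper bound of \<open>R\<close>, and its upper bound is obtained by applying related functions to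
  the generic related pair \<open>w\<close>, \<open>z\<close>.\<close>

lemma sandwiched_expR:
  assumes R: "sandwiched R p q w z" and S: "sandwiched S p' q' w' z'"
  shows "sandwiched (expR R S) (exp_arr B w p') (exp_arr B z q') (exp_arr B p w') (exp_arr B q z')"
proof (rule sandwichedI)
  note r = sandwichedD[OF R] and s = sandwichedD[OF S]
  let ?X = "Exp B (Cod B q) (Dom B z')"
  have "Rel S (Prod B D' ?X) (Eval B (Left R) (Left S) \<cdot> prod_arr B a (exp_arr B p w'))
      (Eval B (Right R) (Right S) \<cdot> prod_arr B b (exp_arr B q z'))" if ab: "Rel R D' a b" for D' a b
  proof -
    note h = admissible_hom[OF r(1) ab]
    \<comment> \<open>Both sides evaluate at the same argument, because \<open>p \<cdot> a = q \<cdot> b\<close> by the upper bound of \<open>R\<close>.\<close>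
    let ?e = "Eval B (Cod B q) (Dom B z') \<cdot> prod_arr B (q \<cdot> b) (Id B ?X)"
    have "Eval B (Left R) (Left S) \<cdot> prod_arr B a (exp_arr B p w') = w' \<cdot> ?e"
      "Eval B (Right R) (Right S) \<cdot> prod_arr B b (exp_arr B q z') = z' \<cdot> ?e"
      using h r s sandwiched_upper[OF R ab] by (simp_all add: prod_arr_def Eval_exp_arr flip: Comp_assoc')
    moreover have "Rel S (Prod B D' ?X) (w' \<cdot> ?e) (z' \<cdot> ?e)"
      by (rule admissible_restrict[OF s(1) sandwiched_lower[OF S]]) (use h r s in simp_all)
    ultimately show ?thesis by simp
  qed
  then show "Rel (expR R S) (Dom B (exp_arr B q z')) (exp_arr B p w') (exp_arr B q z')"
    using r s by (simp add: expR_def hom_iff)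
  fix D x y assume xy: "Rel (expR R S) D x y"
  note h = admissible_hom[OF admissible_expR[OF r(1) s(1)] xy]
  have "Rel S (Prod B (Dom B z) D) (Eval B (Left R) (Left S) \<cdot> prod_arr B w x)
      (Eval B (Right R) (Right S) \<cdot> prod_arr B z y)"
    using xy sandwiched_lower[OF R] by (simp add: expR_def)
  from sandwiched_upper[OF S this]
  have e: "p' \<cdot> Eval B (Left R) (Left S) \<cdot> prod_arr B w x = q' \<cdot> Eval B (Right R) (Right S) \<cdot> prod_arr B z y" .
  show "exp_arr B w p' \<cdot> x = exp_arr B z q' \<cdot> y"
    by (rule exp_eqI[where A = "Dom B z" and C = "Cod B q'"])
      (use h r s e in \<open>simp_all add: prod_arr_def Eval_exp_arr\<close>)
qed (use sandwichedD[OF R] sandwichedD[OF S] in \<open>simp_all add: admissible_expR\<close>)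

text \<open>At the signs of \<open>F\<close>, \<open>from_dom\<close> and \<open>from_cod\<close> are the arguments of \<open>F(A,A) \<turnstile> F(A,C)\<close> and
  \<open>F(C,C) \<turnstile> F(A,C)\<close>; at the opposite signs, those of \<open>F(C,A) \<turnstile> F(A,A)\<close> and \<open>F(C,A) \<turnstile> F(C,C)\<close>.\<close>

definition from_dom :: "bool list \<Rightarrow> 'm list \<Rightarrow> 'm list" where
  "from_dom ss fs = map2 (\<lambda>s f. if s then f else Id B (Dom B f)) ss fs"

definition from_cod :: "bool list \<Rightarrow> 'm list \<Rightarrow> 'm list" where
  "from_cod ss fs = map2 (\<lambda>s f. if s then Id B (Cod B f) else f) ss fs"

lemma from_append:
  assumes "length ss = length fs"
  shows "from_dom (ss @ ss') (fs @ fs') = from_dom ss fs @ from_dom ss' fs'"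
    "from_cod (ss @ ss') (fs @ fs') = from_cod ss fs @ from_cod ss' fs'"
  using assms by (simp_all add: from_dom_def from_cod_def)

lemma length_from [simp]:
  "length (from_dom ss fs) = min (length ss) (length fs)"
  "length (from_cod ss fs) = min (length ss) (length fs)"
  by (simp_all add: from_dom_def from_cod_def)

lemma sandwiched_lift:
  "fs \<in> arrs B (ar B F) \<Longrightarrow> sandwiched (lift F (map graphR fs))
     (amap (funct B F) (from_dom (sg B F) fs)) (amap (funct B F) (from_cod (sg B F) fs))
     (amap (funct B F) (from_dom (map Not (sg B F)) fs)) (amap (funct B F) (from_cod (map Not (sg B F)) fs))"
proof (induction F arbitrary: fs)
  case Var
  then obtain f where "fs = [f]" "f \<in> Arr B" by (auto simp: arrs_def length_Suc_conv simp del: lengths)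
  then show ?case by (simp add: from_dom_def from_cod_def sandwiched_graphR)
next
  case One
  show ?case by (simp add: sandwiched_termR)
next
  case Zero
  show ?case using sandwiched_graphR[of "Id B (Init B)"] by simp
next
  case (Tensor F G)
  from Tensor.prems obtain fs1 fs2 where fs: "fs = fs1 @ fs2"
    and l: "fs1 \<in> arrs B (ar B F)" "fs2 \<in> arrs B (ar B G)"
    unfolding ar_simps by (rule arrs_splitE)
  show ?case
    using sandwiched_prodR[OF Tensor.IH(1)[OF l(1)] Tensor.IH(2)[OF l(2)]] l
    by (simp add: fs combine_def Let_def from_append)
next
  case (Oplus F G)
  from Oplus.prems obtain fs1 fs2 where fs: "fs = fs1 @ fs2"
    and l: "fs1 \<in> arrs B (ar B F)" "fs2 \<in> arrs B (ar B G)"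
    unfolding ar_simps by (rule arrs_splitE)
  show ?case
    using sandwiched_sumR[OF Oplus.IH(1)[OF l(1)] Oplus.IH(2)[OF l(2)]] l
    by (simp add: fs combine_def Let_def from_append)
next
  case (Arrow F G)
  from Arrow.prems obtain fs1 fs2 where fs: "fs = fs1 @ fs2"
    and l: "fs1 \<in> arrs B (ar B F)" "fs2 \<in> arrs B (ar B G)"
    unfolding ar_simps by (rule arrs_splitE)
  show ?case
    using sandwiched_expR[OF Arrow.IH(1)[OF l(1)] Arrow.IH(2)[OF l(2)]] l
    by (simp add: fs combine_def Let_def from_append comp_def)
qed

text \<open>Typing is the part of preservation of relations that concerns their left sides alone; graphs of identities
  supply relations with arbitrary left sides.\<close>

lemma is_family_canonical:
  assumes \<alpha>: "canonical B F G \<Gamma> \<alpha>"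
  shows "is_family B (funct B F) (funct B G) \<Gamma> \<alpha>"
  unfolding is_family_def
proof
  fix As assume As: "As \<in> obs B (ncomp \<Gamma>)"
  let ?Rs = "map (\<lambda>A. graphR (Id B A)) As"
  have g: "is_graph \<Gamma>" "lsign \<Gamma> = sg B F" "rsign \<Gamma> = sg B G"
    using graph_of_canonical[OF \<alpha>] by simp_all
  have ob: "\<And>A. A \<in> set As \<Longrightarrow> A \<in> Ob B" using As by (auto simp: obs_def simp del: lengths)
  have R: "?Rs \<in> rels (ncomp \<Gamma>)"
    using As ob by (auto simp: rels_def admissible_graphR simp del: rels_length)
  have L: "map Left ?Rs = As" using ob by (auto simp: map_idI)
  have r: "reindex ?Rs (lcomp \<Gamma>) \<in> rels (ar B F)" "reindex ?Rs (rcomp \<Gamma>) \<in> rels (ar B G)"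
    using reindex_rels[OF R, of "lcomp \<Gamma>"] reindex_rels[OF R, of "rcomp \<Gamma>"] g
    by (auto simp: is_graph_def)
  have "morph (lift F (reindex ?Rs (lcomp \<Gamma>))) (lift G (reindex ?Rs (rcomp \<Gamma>)))
      (\<alpha> (map Left ?Rs)) (\<alpha> (map Right ?Rs))"
    using rel_family_canonical[OF \<alpha>] R unfolding rel_family_def by blast
  from morph_simps(1-3)[OF this]
  have "\<alpha> As \<in> hom B (Left (lift F (reindex ?Rs (lcomp \<Gamma>)))) (Left (lift G (reindex ?Rs (rcomp \<Gamma>))))"
    unfolding L hom_iff by simp
  moreover have "map Left (reindex ?Rs (lcomp \<Gamma>)) = reindex As (lcomp \<Gamma>)"
    "map Left (reindex ?Rs (rcomp \<Gamma>)) = reindex As (rcomp \<Gamma>)"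
    using g R map_reindex[of "lcomp \<Gamma>" ?Rs Left] map_reindex[of "rcomp \<Gamma>" ?Rs Left] L lengths(1)[OF As]
    by (auto simp: is_graph_def simp del: map_map)
  ultimately show "\<alpha> As \<in> hom B (omap (funct B F) (reindex As (lcomp \<Gamma>)))
      (omap (funct B G) (reindex As (rcomp \<Gamma>)))"
    using lift_sides(1)[OF r(1)] lift_sides(1)[OF r(2)] by (simp del: map_map)
qed

text \<open>With \<open>f\<close> at component \<open>i\<close> and identities elsewhere, the four tuples in the
  definition of g-dinaturality are the arguments of the four arrows that bound a lifted relation.\<close>

lemma place_arrows_from:
  assumes f: "f \<in> Arr B" and As: "As \<in> obs B n" and i: "i < n"
    and cs: "set cs \<subseteq> {..<n}" "length ss = length cs"
  defines "fs \<equiv> (map (Id B) As)[i := f]"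
  shows "place_arrows B As i ss cs f (Id B (Dom B f)) = from_dom ss (reindex fs cs)"
    "place_arrows B As i ss cs (Id B (Cod B f)) f = from_cod ss (reindex fs cs)"
    "place_arrows B As i ss cs (Id B (Dom B f)) f = from_dom (map Not ss) (reindex fs cs)"
    "place_arrows B As i ss cs f (Id B (Cod B f)) = from_cod (map Not ss) (reindex fs cs)"
proof -
  have l: "length As = n" using As by simp
  have ob: "\<And>c. c < n \<Longrightarrow> As ! c \<in> Ob B" using As by (auto simp: obs_def simp del: lengths)
  have c: "\<And>j. j < length cs \<Longrightarrow> cs ! j < n" using cs nth_mem by fastforce
  have e: "reindex fs cs ! j = (if cs ! j = i then f else Id B (As ! (cs ! j)))" if "j < length cs" for j
    using that c[OF that] l by (simp add: fs_def reindex_def nth_list_update)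
  show "place_arrows B As i ss cs f (Id B (Dom B f)) = from_dom ss (reindex fs cs)"
    "place_arrows B As i ss cs (Id B (Cod B f)) f = from_cod ss (reindex fs cs)"
    "place_arrows B As i ss cs (Id B (Dom B f)) f = from_dom (map Not ss) (reindex fs cs)"
    "place_arrows B As i ss cs f (Id B (Cod B f)) = from_cod (map Not ss) (reindex fs cs)"
    unfolding place_arrows_def from_dom_def from_cod_def
    by (rule nth_equalityI; use cs c e ob in simp)+
qed

lemma g_dinatural_canonical:
  assumes \<alpha>: "canonical B F G \<Gamma> \<alpha>"
  shows "g_dinatural B (funct B F) (funct B G) \<Gamma> \<alpha>"
proof -
  have g: "is_graph \<Gamma>" "lsign \<Gamma> = sg B F" "rsign \<Gamma> = sg B G"
    using graph_of_canonical[OF \<alpha>] by simp_all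
  have cs: "set (lcomp \<Gamma>) \<subseteq> {..<ncomp \<Gamma>}" "length (sg B F) = length (lcomp \<Gamma>)"
    "set (rcomp \<Gamma>) \<subseteq> {..<ncomp \<Gamma>}" "length (sg B G) = length (rcomp \<Gamma>)"
    using g by (simp_all add: is_graph_def)
  have "amap (funct B G) (place_arrows B As i (sg B G) (rcomp \<Gamma>) (Id B (Cod B f)) f) \<cdot>
      \<alpha> (As[i := Cod B f]) \<cdot> amap (funct B F) (place_arrows B As i (sg B F) (lcomp \<Gamma>) f (Id B (Cod B f)))
    = amap (funct B G) (place_arrows B As i (sg B G) (rcomp \<Gamma>) f (Id B (Dom B f))) \<cdot>
      \<alpha> (As[i := Dom B f]) \<cdot> amap (funct B F) (place_arrows B As i (sg B F) (lcomp \<Gamma>) (Id B (Dom B f)) f)"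
    if i: "i < ncomp \<Gamma>" and As: "As \<in> obs B (ncomp \<Gamma>)" and f: "f \<in> Arr B" for i As f
  proof -
    define fs where "fs = (map (Id B) As)[i := f]"
    let ?Rs = "map graphR fs"
    have ob: "\<And>A. A \<in> set As \<Longrightarrow> A \<in> Ob B" and l: "length As = ncomp \<Gamma>"
      using As by (auto simp: obs_def simp del: lengths)
    have fs: "set fs \<subseteq> Arr B" "length fs = ncomp \<Gamma>"
      using f ob l set_update_subset_insert[of "map (Id B) As" i f] by (auto simp: fs_def)
    have R: "?Rs \<in> rels (ncomp \<Gamma>)"
      using fs by (auto simp: rels_def admissible_graphR simp del: rels_length)
    have LR: "map Left ?Rs = As[i := Dom B f]" "map Right ?Rs = As[i := Cod B f]"
      by (rule nth_equalityI; use l ob i in \<open>auto simp: fs_def nth_list_update\<close>)+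
    have m: "morph (lift F (reindex ?Rs (lcomp \<Gamma>))) (lift G (reindex ?Rs (rcomp \<Gamma>)))
        (\<alpha> (As[i := Dom B f])) (\<alpha> (As[i := Cod B f]))"
      using rel_family_canonical[OF \<alpha>] R unfolding rel_family_def LR[symmetric] by blast
    have arrs: "reindex fs (lcomp \<Gamma>) \<in> arrs B (ar B F)" "reindex fs (rcomp \<Gamma>) \<in> arrs B (ar B G)"
      using fs cs set_reindex[of "lcomp \<Gamma>" fs] set_reindex[of "rcomp \<Gamma>" fs]
      unfolding arrs_def by auto
    have re: "reindex ?Rs (lcomp \<Gamma>) = map graphR (reindex fs (lcomp \<Gamma>))"
      "reindex ?Rs (rcomp \<Gamma>) = map graphR (reindex fs (rcomp \<Gamma>))"
      using fs cs by (simp_all add: map_reindex)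
    \<comment> \<open>From right to left in the composites: the lower bound for \<open>F\<close>, the family, the upper bound for \<open>G\<close>.\<close>
    show ?thesis
      using sandwiched_upper[OF sandwiched_lift[OF arrs(2)]
          morph_rel[OF m[unfolded re] sandwiched_lower[OF sandwiched_lift[OF arrs(1)]]]]
      unfolding place_arrows_from[OF f As i cs(1,2), folded fs_def]
        place_arrows_from[OF f As i cs(3,4), folded fs_def] by simp
  qed
  then show ?thesis
    using g is_functor_funct is_family_canonical[OF \<alpha>]
    by (auto simp: g_dinatural_def Let_def hom_iff)
qed

end

theorem theorem5p4:
  fixes B :: "('o, 'm) bcc" and F G :: fob and \<Gamma> :: graph and \<alpha> :: "'o list \<Rightarrow> 'm"
  assumes "bicartesian_closed B"
    and "canonical B F G \<Gamma> \<alpha>"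
  shows "g_dinatural B (funct B F) (funct B G) \<Gamma> \<alpha>"
  using bicartesian_closed.g_dinatural_canonical[OF assms] .

end
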